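(* Let $R$ be a commutative Noetherian ring with $1$, let $N\in\mathbb{N}$, and for each $p\in[N]$ let $k_p\geq 1$ be an integer. Then the ring $$S=R\Big[x^A \;\Big|\; A\in\prod_{p\in[N]}\mathbb{N}^{[k_p]\times\mathbb{N}}\ \text{good}\Big]$$ is $\mathrm{Inc}(\mathbb{N})$-Noetherian.
   Context: $\mathbb{N}=\{0,1,2,\ldots\}$ and $[k]=\{0,\ldots,k-1\}$. $\mathrm{Inc}(\mathbb{N})$ is the monoid of strictly increasing maps $\mathbb{N}\to\mathbb{N}$. Let $X$ be the set of variables $x_{p,l,j}$ with $p\in[N]$, $l\in[k_p]$, $j\in\mathbb{N}$. For an $[N]$-tuple $A=(A_p)_{p\in[N]}$ of matrices $A_p\in\mathbb{N}^{[k_p]\times\mathbb{N}}$ with only finitely many nonzero entries, $x^A=\prod_{p,l,j}x_{p,l,j}^{A_{p,l,j}}$. Such an $A$ is called good if for every $p\in[N]$ there is $d_p\in\mathbb{N}$ such that all row sums of $A_p$ are equal to $d_p$ and all column sums of $A_p$ are at most $d_p$. The good tuples form a monoid under addition and $S\subseteq R[X]$ is its monoid ring (the $R$-span of the monomials $x^A$, $A$ good). $\mathrm{Inc}(\mathbb{N})$ acts on $R[X]$ by $R$-algebra endomorphisms via $\pi x_{p,l,j}=x_{p,l,\pi(j)}$, and this preserves $S$. When a monoid $\Pi$ acts on a ring $T$ by endomorphisms, $T$ is called $\Pi$-Noetherian if every $\Pi$-stable ideal of $T$ is generated by the union of finitely many $\Pi$-orbits of elements. *)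

theory Defs
  imports "HOL-Library.Poly_Mapping" "HOL-Algebra.Ring_Divisibility"
begin

text \<open>
  Monoids acting on rings by endomorphisms. As the monoid may be noncommutative, the action is
  a left action: \<open>\<pi> \<otimes> \<sigma>\<close> acts as \<open>\<sigma>\<close> followed by \<open>\<pi>\<close>.
\<close>

locale ring_monoid_action = monoid G + T?: ring T
  for G :: "('g, 'm) monoid_scheme" (structure)
    and T :: "('t, 'n) ring_scheme" (structure)
    and act :: "'g \<Rightarrow> 't \<Rightarrow> 't" +
  assumes act_hom: "\<pi> \<in> carrier G \<Longrightarrow> act \<pi> \<in> ring_hom T T"
    and act_one: "f \<in> carrier T \<Longrightarrow> act \<one>\<^bsub>G\<^esub> f = f"
    and act_mult: "\<lbrakk>\<pi> \<in> carrier G; \<sigma> \<in> carrier G; f \<in> carrier T\<rbrakk>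
      \<Longrightarrow> act (\<pi> \<otimes>\<^bsub>G\<^esub> \<sigma>) f = act \<pi> (act \<sigma> f)"

locale equivariantly_noetherian_ring = ring_monoid_action +
  assumes finitely_orbit_generated:
    "\<lbrakk>ideal I T; \<And>\<pi> f. \<pi> \<in> carrier G \<Longrightarrow> f \<in> I \<Longrightarrow> act \<pi> f \<in> I\<rbrakk>
      \<Longrightarrow> \<exists>F \<subseteq> carrier T. finite F \<and> I = Idl\<^bsub>T\<^esub> (\<Union>f\<in>F. (\<lambda>\<pi>. act \<pi> f) ` carrier G)"

definition Inc_monoid :: "(nat \<Rightarrow> nat) monoid" where
  "Inc_monoid = \<lparr>carrier = {\<pi>. strict_mono \<pi>}, mult = (\<circ>), one = id\<rparr>"

text \<open>
  The sort \<open>{comm_ring, comm_monoid_mult}\<close> is used for the coefficients instead of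
  \<open>comm_ring_1\<close> because the latter contains the axiom \<open>0 \<noteq> 1\<close> and so excludes the zero ring.
\<close>

definition coeff_ring :: "'a::{comm_ring, comm_monoid_mult} ring" where
  "coeff_ring = \<lparr>carrier = UNIV, mult = (*), one = 1, zero = 0, add = (+)\<rparr>"

text \<open>
  The triple \<open>(p, l, j)\<close> is the index of the variable \<open>x\<^bsub>p,l,j\<^esub>\<close>. A tuple of
  matrices \<open>A\<close> is a finitely supported function on such triples, with the entry \<open>(l, j)\<close> of the
  matrix \<open>A\<^sub>p\<close> at \<open>(p, l, j)\<close>, and it doubles as the exponent of the monomial \<open>x\<^sup>A\<close>, which is
  \<open>Poly_Mapping.single A 1\<close>. All triples of natural numbers are allowed here; the ranges
  \<open>p < N\<close> and \<open>l < k p\<close> are imposed by \<open>good\<close>.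
\<close>

type_synonym var = "nat \<times> nat \<times> nat"
type_synonym expo = "var \<Rightarrow>\<^sub>0 nat"

definition good :: "nat \<Rightarrow> (nat \<Rightarrow> nat) \<Rightarrow> expo \<Rightarrow> bool" where
  "good N k A \<longleftrightarrow>
     (\<forall>(p, l, j) \<in> Poly_Mapping.keys A. p < N \<and> l < k p) \<and>
     (\<forall>p<N. \<exists>d.
        (\<forall>l<k p. Sum_any (\<lambda>j. Poly_Mapping.lookup A (p, l, j)) = d) \<and>
        (\<forall>j. (\<Sum>l<k p. Poly_Mapping.lookup A (p, l, j)) \<le> d))"

definition good_ring ::
    "nat \<Rightarrow> (nat \<Rightarrow> nat) \<Rightarrow> (expo \<Rightarrow>\<^sub>0 'a::{comm_ring, comm_monoid_mult}) ring" where
  "good_ring N k =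
     \<lparr>carrier = {f. \<forall>A \<in> Poly_Mapping.keys f. good N k A},
      mult = (*), one = Poly_Mapping.single 0 1, zero = 0, add = (+)\<rparr>"

text \<open>The linear extension of a map between basis elements.\<close>

definition push :: "('x \<Rightarrow> 'y) \<Rightarrow> ('x \<Rightarrow>\<^sub>0 'b::comm_monoid_add) \<Rightarrow> 'y \<Rightarrow>\<^sub>0 'b" where
  "push h f = (\<Sum>x\<in>Poly_Mapping.keys f. Poly_Mapping.single (h x) (Poly_Mapping.lookup f x))"

text \<open>
  The algebra endomorphism with \<open>x\<^bsub>p,l,j\<^esub> \<mapsto> x\<^bsub>p,l,\<pi> j\<^esub>\<close>; see the lemmas
  \<open>inc_act_const\<close>, \<open>inc_act_var\<close>, \<open>inc_act_add\<close> and \<open>inc_act_mult\<close> below.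
\<close>

definition inc_act ::
    "(nat \<Rightarrow> nat) \<Rightarrow> (expo \<Rightarrow>\<^sub>0 'a::{comm_ring, comm_monoid_mult}) \<Rightarrow> expo \<Rightarrow>\<^sub>0 'a" where
  "inc_act \<pi> = push (push (\<lambda>(p, l, j). (p, l, \<pi> j)))"

lemma push_superset:
  assumes "finite X" "Poly_Mapping.keys f \<subseteq> X"
  shows "push h f = (\<Sum>x\<in>X. Poly_Mapping.single (h x) (Poly_Mapping.lookup f x))"
  unfolding push_def
  by (rule sum.mono_neutral_left) (use assms in \<open>auto simp: in_keys_iff\<close>)

lemma push_zero [simp]: "push h 0 = 0"
  by (simp add: push_def)

lemma push_single [simp]: "push h (Poly_Mapping.single x c) = Poly_Mapping.single (h x) c"
  by (subst push_superset[of "{x}"]) auto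

lemma push_add: "push h (f + g) = push h f + push h g"
proof -
  let ?X = "Poly_Mapping.keys f \<union> Poly_Mapping.keys g"
  have "finite ?X" "Poly_Mapping.keys (f + g) \<subseteq> ?X"
    using Poly_Mapping.keys_add[of f g] by auto
  then show ?thesis
    by (subst (1 2 3) push_superset[of ?X])
       (auto simp: lookup_add single_add sum.distrib)
qed

lemma push_sum: "push h (sum f X) = (\<Sum>x\<in>X. push h (f x))"
  by (induction X rule: infinite_finite_induct) (auto simp: push_add)

lemma sum_single_eq:
  "(\<Sum>x\<in>Poly_Mapping.keys f. Poly_Mapping.single x (Poly_Mapping.lookup f x)) = f"
  by (rule poly_mapping_eqI)
     (auto simp: lookup_sum lookup_single when_def in_keys_iff)

lemma push_ident: "push (\<lambda>x. x) = (\<lambda>f. f)"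
  by (simp add: fun_eq_iff push_def sum_single_eq)

lemma push_push: "push h (push g f) = push (\<lambda>x. h (g x)) f"
  by (simp add: push_def[of _ f] push_sum)

lemma push_mult:
  fixes f g :: "'x::monoid_add \<Rightarrow>\<^sub>0 'b::semiring_0" and h :: "'x \<Rightarrow> 'y::monoid_add"
  assumes "\<And>x y. h (x + y) = h x + h y"
  shows "push h (f * g) = push h f * push h g"
proof -
  have "push h (f * g) = push h
      ((\<Sum>x\<in>Poly_Mapping.keys f. Poly_Mapping.single x (Poly_Mapping.lookup f x)) *
       (\<Sum>x\<in>Poly_Mapping.keys g. Poly_Mapping.single x (Poly_Mapping.lookup g x)))"
    by (simp add: sum_single_eq)
  then show ?thesis
    unfolding push_def[of _ f] push_def[of _ g] sum_product
    by (simp add: push_sum mult_single assms)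
qed

lemma lookup_push_inj:
  assumes "inj h"
  shows "Poly_Mapping.lookup (push h f) (h x) = Poly_Mapping.lookup f x"
  using assms by (auto simp: push_def lookup_sum lookup_single when_def inj_eq in_keys_iff)

lemma lookup_push_outside:
  assumes "y \<notin> range h"
  shows "Poly_Mapping.lookup (push h f) y = 0"
  using assms by (auto simp: push_def lookup_sum lookup_single when_def intro!: sum.neutral)

lemma keys_push_subset: "Poly_Mapping.keys (push h f) \<subseteq> h ` Poly_Mapping.keys f"
proof
  fix y assume "y \<in> Poly_Mapping.keys (push h f)"
  then show "y \<in> h ` Poly_Mapping.keys f"
    by (auto simp: push_def in_keys_iff lookup_sum lookup_single when_def
        elim!: sum.not_neutral_contains_not_neutral split: if_splits)
qed

lemma good_zero: "good N k 0"
  by (auto simp: good_def)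

lemma finite_row: "finite {j. Poly_Mapping.lookup (A :: expo) (p, l, j) \<noteq> 0}"
proof (rule finite_subset)
  show "{j. Poly_Mapping.lookup A (p, l, j) \<noteq> 0} \<subseteq> (snd \<circ> snd) ` Poly_Mapping.keys A"
    by (force simp: in_keys_iff image_iff)
qed simp

lemma good_add:
  assumes "good N k A" "good N k B"
  shows "good N k (A + B)"
proof -
  have "\<exists>d. (\<forall>l<k p. Sum_any (\<lambda>j. Poly_Mapping.lookup (A + B) (p, l, j)) = d) \<and>
      (\<forall>j. (\<Sum>l<k p. Poly_Mapping.lookup (A + B) (p, l, j)) \<le> d)" if p: "p < N" for p
  proof -
    from assms p obtain d e where
      "\<forall>l<k p. Sum_any (\<lambda>j. Poly_Mapping.lookup A (p, l, j)) = d"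
      "\<forall>j. (\<Sum>l<k p. Poly_Mapping.lookup A (p, l, j)) \<le> d"
      "\<forall>l<k p. Sum_any (\<lambda>j. Poly_Mapping.lookup B (p, l, j)) = e"
      "\<forall>j. (\<Sum>l<k p. Poly_Mapping.lookup B (p, l, j)) \<le> e"
      unfolding good_def by meson
    then show ?thesis
      by (intro exI[of _ "d + e"])
         (simp add: lookup_add sum.distrib Sum_any.distrib[OF finite_row finite_row] add_mono)
  qed
  moreover have "\<forall>(p, l, j) \<in> Poly_Mapping.keys (A + B). p < N \<and> l < k p"
    using assms Poly_Mapping.keys_add[of A B] unfolding good_def by blast
  ultimately show ?thesis
    by (simp add: good_def)
qed

lemma good_push:
  assumes "good N k A" and mono: "strict_mono \<pi>"
  shows "good N k (push (\<lambda>(p, l, j). (p, l, \<pi> j)) A)"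
proof -
  define h :: "var \<Rightarrow> var" where "h = (\<lambda>(p, l, j). (p, l, \<pi> j))"
  have inj: "inj \<pi>" using mono by (simp add: strict_mono_imp_inj_on)
  then have injh: "inj h" by (auto simp: h_def inj_def)
  have in_range: "Poly_Mapping.lookup (push h A) (p, l, \<pi> j) = Poly_Mapping.lookup A (p, l, j)"
    for p l j
    using lookup_push_inj[OF injh, of A "(p, l, j)"] by (simp add: h_def)
  have outside: "Poly_Mapping.lookup (push h A) (p, l, j) = 0" if "j \<notin> range \<pi>" for p l j
    by (rule lookup_push_outside) (use that in \<open>auto simp: h_def\<close>)
  have row: "Sum_any (\<lambda>j. Poly_Mapping.lookup (push h A) (p, l, j)) =
      Sum_any (\<lambda>j. Poly_Mapping.lookup A (p, l, j))" for p l
  proof -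
    have eq: "{j. Poly_Mapping.lookup (push h A) (p, l, j) \<noteq> 0} =
        \<pi> ` {j. Poly_Mapping.lookup A (p, l, j) \<noteq> 0}"
    proof (rule equalityI; rule subsetI)
      fix j assume j: "j \<in> {j. Poly_Mapping.lookup (push h A) (p, l, j) \<noteq> 0}"
      then have "j \<in> range \<pi>" using outside[of j p l] by auto
      then obtain i where "j = \<pi> i" by auto
      then show "j \<in> \<pi> ` {j. Poly_Mapping.lookup A (p, l, j) \<noteq> 0}"
        using j in_range[of p l i] by auto
    next
      fix j assume "j \<in> \<pi> ` {j. Poly_Mapping.lookup A (p, l, j) \<noteq> 0}"
      then show "j \<in> {j. Poly_Mapping.lookup (push h A) (p, l, j) \<noteq> 0}"
        by (auto simp: in_range)
    qed
    have "inj_on \<pi> {j. Poly_Mapping.lookup A (p, l, j) \<noteq> 0}"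
      using inj by (rule inj_on_subset) simp
    then show ?thesis
      by (simp only: Sum_any.expand_set eq sum.reindex o_def in_range)
  qed
  have col: "(\<Sum>l<k p. Poly_Mapping.lookup (push h A) (p, l, j)) \<le> d"
    if "\<forall>j. (\<Sum>l<k p. Poly_Mapping.lookup A (p, l, j)) \<le> d" for p d j
  proof (cases "j \<in> range \<pi>")
    case True
    then show ?thesis using that by (auto simp: in_range)
  next
    case False
    then show ?thesis by (simp add: outside)
  qed
  have "\<forall>(p, l, j) \<in> Poly_Mapping.keys (push h A). p < N \<and> l < k p"
  proof safe
    fix p l j assume "(p, l, j) \<in> Poly_Mapping.keys (push h A)"
    then obtain j' where "(p, l, j') \<in> Poly_Mapping.keys A"
      using keys_push_subset[of h A] by (auto simp: h_def)
    then show "p < N" "l < k p"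
      using assms(1) by (auto simp: good_def)
  qed
  moreover have "\<exists>d. (\<forall>l<k p. Sum_any (\<lambda>j. Poly_Mapping.lookup (push h A) (p, l, j)) = d) \<and>
      (\<forall>j. (\<Sum>l<k p. Poly_Mapping.lookup (push h A) (p, l, j)) \<le> d)" if "p < N" for p
  proof -
    from assms(1) that obtain d where
      "\<forall>l<k p. Sum_any (\<lambda>j. Poly_Mapping.lookup A (p, l, j)) = d"
      "\<forall>j. (\<Sum>l<k p. Poly_Mapping.lookup A (p, l, j)) \<le> d"
      unfolding good_def by meson
    then show ?thesis
      using col row by (intro exI[of _ d]) simp
  qed
  ultimately have "good N k (push h A)"
    by (simp add: good_def)
  then show ?thesis by (simp add: h_def)
qed

lemma monoid_Inc: "monoid Inc_monoid"
  by (unfold_locales) (auto simp: Inc_monoid_def strict_mono_def)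

lemma cring_coeff_ring: "cring (coeff_ring :: 'a::{comm_ring, comm_monoid_mult} ring)"
proof (intro cringI abelian_groupI comm_monoidI)
  fix x :: 'a
  show "\<exists>y\<in>carrier coeff_ring. y \<oplus>\<^bsub>coeff_ring\<^esub> x = \<zero>\<^bsub>coeff_ring\<^esub>"
    by (rule bexI[of _ "- x"]) (auto simp: coeff_ring_def)
qed (auto simp: coeff_ring_def algebra_simps)

lemma cring_good_ring:
  "cring (good_ring N k :: (expo \<Rightarrow>\<^sub>0 'a::{comm_ring, comm_monoid_mult}) ring)"
proof (intro cringI abelian_groupI comm_monoidI)
  fix x :: "expo \<Rightarrow>\<^sub>0 'a"
  assume "x \<in> carrier (good_ring N k)"
  then show "\<exists>y\<in>carrier (good_ring N k). y \<oplus>\<^bsub>good_ring N k\<^esub> x = \<zero>\<^bsub>good_ring N k\<^esub>"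
    by (intro bexI[of _ "- x"]) (auto simp: good_ring_def keys_def)
next
  fix x y :: "expo \<Rightarrow>\<^sub>0 'a"
  assume xy: "x \<in> carrier (good_ring N k)" "y \<in> carrier (good_ring N k)"
  show "x \<oplus>\<^bsub>good_ring N k\<^esub> y \<in> carrier (good_ring N k)"
    using xy Poly_Mapping.keys_add[of x y] by (auto simp: good_ring_def)
  show "x \<otimes>\<^bsub>good_ring N k\<^esub> y \<in> carrier (good_ring N k)"
    using xy keys_mult[of x y] good_add by (fastforce simp: good_ring_def)
next
  fix x :: "expo \<Rightarrow>\<^sub>0 'a"
  have "Poly_Mapping.single 0 1 * x = x" 
    by (subst (1 2) sum_single_eq[of x, symmetric]) (simp add: sum_distrib_left mult_single)
  then show "\<one>\<^bsub>good_ring N k\<^esub> \<otimes>\<^bsub>good_ring N k\<^esub> x = x"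
    by (simp add: good_ring_def)
qed (auto simp: good_ring_def algebra_simps good_zero)

lemma inc_act_const: "inc_act \<pi> (Poly_Mapping.single 0 c) = Poly_Mapping.single 0 c"
  by (simp add: inc_act_def)

lemma inc_act_var:
  "inc_act \<pi> (Poly_Mapping.single (Poly_Mapping.single (p, l, j) 1) 1) =
   Poly_Mapping.single (Poly_Mapping.single (p, l, \<pi> j) 1) 1"
  by (simp add: inc_act_def)

lemma inc_act_add: "inc_act \<pi> (f + g) = inc_act \<pi> f + inc_act \<pi> g"
  by (simp add: inc_act_def push_add)

lemma inc_act_mult: "inc_act \<pi> (f * g) = inc_act \<pi> f * inc_act \<pi> g"
  by (simp add: inc_act_def push_mult push_add)

lemma inc_act_id: "inc_act id f = f"
  by (simp add: inc_act_def push_ident case_prod_unfold)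

lemma inc_act_comp: "inc_act (\<pi> \<circ> \<sigma>) f = inc_act \<pi> (inc_act \<sigma> f)"
  by (simp add: inc_act_def push_push case_prod_unfold)

lemma inc_act_good_ring:
  assumes "strict_mono \<pi>" "f \<in> carrier (good_ring N k)"
  shows "inc_act \<pi> f \<in> carrier (good_ring N k)"
  using assms keys_push_subset[of "push (\<lambda>(p, l, j). (p, l, \<pi> j))" f] good_push
  by (auto simp: good_ring_def inc_act_def)

lemma ring_monoid_action_inc_act:
  "ring_monoid_action Inc_monoid
     (good_ring N k :: (expo \<Rightarrow>\<^sub>0 'a::{comm_ring, comm_monoid_mult}) ring) inc_act"
proof -
  interpret S: cring "good_ring N k :: (expo \<Rightarrow>\<^sub>0 'a) ring" by (rule cring_good_ring)
  interpret monoid Inc_monoid by (rule monoid_Inc)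
  show ?thesis
  proof unfold_locales
    fix \<pi> :: "nat \<Rightarrow> nat" assume "\<pi> \<in> carrier Inc_monoid"
    then show "inc_act \<pi> \<in> ring_hom (good_ring N k :: (expo \<Rightarrow>\<^sub>0 'a) ring) (good_ring N k)"
      by (intro ring_hom_memI)
         (auto simp: Inc_monoid_def inc_act_good_ring,
          auto simp: good_ring_def inc_act_const inc_act_add inc_act_mult)
  qed (auto simp: Inc_monoid_def inc_act_id inc_act_comp)
qed

end

theory Submission
  imports Defs "HOL-Library.Ramsey" "HOL-Library.Sublist" "HOL-Library.Product_Lexorder"
begin

text \<open>
The proof compares monomials by divisibility up to shifts: \<open>good_divides N k A B\<close> says that
\<open>B = \<pi> A + C\<close> with \<open>\<pi>\<close> strictly increasing and \<open>C\<close> good, that is, \<open>x\<^sup>B\<close> is a multiple in the ring of a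
shift of \<open>x\<^sup>A\<close>. Two facts carry the proof: every infinite sequence of good tuples contains two
terms of which the earlier divides the later (\<open>almost_full_good_divides\<close>), and the leading monomial
argument of Hilbert's basis theorem works for this divisibility
(\<open>stable_ideal_finitely_orbit_generated\<close>).

For the first fact, read a good tuple as the word of its columns, and call \<open>d\<^sub>p\<close> minus a column sum
the slack of that column. Then \<open>A\<close> divides \<open>B\<close> along \<open>\<pi>\<close> if the entries and the slack of columns do not
decrease along \<open>\<pi>\<close>, and if the columns of \<open>B\<close> missed by \<open>\<pi>\<close> have slack at least the degree of \<open>A\<close>. Higman's lemma
provides the former. It says nothing about the columns that are missed, but those of \<open>B\<close> with too
little slack are few: after passing to a subsequence, each \<open>d\<^sub>p\<close> is either constant or doubles in
every step, and in both cases the number of such columns is bounded along the sequence, as all the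
entries of \<open>A\<^sub>p\<close> add up to just \<open>k\<^sub>p d\<^sub>p\<close>. So this number may be taken to be constant. Marking these
columns in the words then forces an embedding to hit all of them, by counting.

For the second fact, monomials are ordered by their exponent at the largest variable where they
differ. This order is compatible with multiplication and with shifts, and a monomial is never
larger than a multiple of a shift of it, so the first fact makes the order well-founded on good
monomials. It remains to cancel leading terms, using that the coefficients are Noetherian.
\<close>

section \<open>Well-quasi-orders and Higman's lemma\<close>

text \<open>
  For a quasi-order this says that it is a well-quasi-order.
\<close>

definition almost_full_on :: "('b \<Rightarrow> 'b \<Rightarrow> bool) \<Rightarrow> 'b set \<Rightarrow> bool" where
  "almost_full_on P S \<longleftrightarrow> (\<forall>f :: nat \<Rightarrow> 'b. (\<forall>i. f i \<in> S) \<longrightarrow> (\<exists>i j. i < j \<and> P (f i) (f j)))"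

lemma almost_full_onD:
  assumes "almost_full_on P S" "\<And>i::nat. f i \<in> S"
  obtains i j where "i < j" "P (f i) (f j)"
  using assms unfolding almost_full_on_def by blast

text \<open>
  Ramsey's theorem for pairs of indices, coloured by whether \<open>P\<close> relates the two terms.
\<close>

lemma homogeneous_subsequence:
  fixes f :: "nat \<Rightarrow> 'b"
  obtains \<phi> :: "nat \<Rightarrow> nat" where "strict_mono \<phi>"
    "(\<forall>i j. i < j \<longrightarrow> P (f (\<phi> i)) (f (\<phi> j))) \<or> (\<forall>i j. i < j \<longrightarrow> \<not> P (f (\<phi> i)) (f (\<phi> j)))"
proof -
  define c :: "nat set \<Rightarrow> nat" where "c = (\<lambda>X. if P (f (Min X)) (f (Max X)) then 1 else 0)"
  have "\<exists>Y t. Y \<subseteq> (UNIV :: nat set) \<and> infinite Y \<and> t < 2 \<and>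
      (\<forall>x\<in>Y. \<forall>y\<in>Y. x \<noteq> y \<longrightarrow> c {x, y} = t)"
    by (rule Ramsey2) (auto simp: c_def)
  then obtain Y t where Y: "infinite Y" "\<forall>x\<in>Y. \<forall>y\<in>Y. x \<noteq> y \<longrightarrow> c {x, y} = t"
    by (elim exE conjE)
  let ?\<phi> = "enumerate Y"
  have sm: "strict_mono ?\<phi>"
    using Y(1) by (auto simp: strict_mono_def enumerate_mono)
  have "P (f (?\<phi> i)) (f (?\<phi> j)) \<longleftrightarrow> t = 1" if "i < j" for i j
  proof -
    have lt: "?\<phi> i < ?\<phi> j" using sm that by (simp add: strict_mono_def)
    have "c {?\<phi> i, ?\<phi> j} = t"
      using Y(2) lt enumerate_in_set[OF Y(1)] by (metis less_irrefl)
    with lt show ?thesis by (auto simp: c_def split: if_splits)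
  qed
  then show thesis by (intro that[OF sm]) blast
qed

lemma almost_full_subsequence:
  assumes "almost_full_on P S" "\<And>i::nat. f i \<in> S"
  obtains \<phi> :: "nat \<Rightarrow> nat" where "strict_mono \<phi>" "\<And>i j. i < j \<Longrightarrow> P (f (\<phi> i)) (f (\<phi> j))"
proof -
  obtain \<phi> :: "nat \<Rightarrow> nat" where \<phi>: "strict_mono \<phi>"
    "(\<forall>i j. i < j \<longrightarrow> P (f (\<phi> i)) (f (\<phi> j))) \<or> (\<forall>i j. i < j \<longrightarrow> \<not> P (f (\<phi> i)) (f (\<phi> j)))"
    by (rule homogeneous_subsequence)
  obtain i j where "i < j" "P (f (\<phi> i)) (f (\<phi> j))"
    using assms by (elim almost_full_onD[where f = "f \<circ> \<phi>"]) auto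
  with \<phi> show thesis by (blast intro: that)
qed

lemma finite_almost_full: "finite S \<Longrightarrow> almost_full_on (=) S"
proof (unfold almost_full_on_def, intro allI impI)
  fix f :: "nat \<Rightarrow> 'a" assume S: "finite S" "\<forall>i. f i \<in> S"
  have "finite (range f)" by (rule finite_subset[OF _ S(1)]) (use S(2) in auto)
  then have "\<not> inj f" using finite_imageD[of f UNIV] by auto
  then obtain i j where "i \<noteq> j" "f i = f j" unfolding inj_def by blast
  then show "\<exists>i j. i < j \<and> f i = f j" by (metis nat_neq_iff)
qed

lemma almost_full_nat_le: "almost_full_on (\<le>) (UNIV :: nat set)"
proof (unfold almost_full_on_def, intro allI impI)
  fix f :: "nat \<Rightarrow> nat"
  show "\<exists>i j. i < j \<and> f i \<le> f j"
  proof (rule ccontr)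
    assume "\<not> ?thesis"
    then have desc: "f (Suc i) < f i" for i using lessI[of i] not_le by blast
    have "f n + n \<le> f 0" for n
    proof (induction n)
      case (Suc n)
      then show ?case using desc[of n] by linarith
    qed simp
    from this[of "Suc (f 0)"] show False by simp
  qed
qed

text \<open>
  The indices of \<open>I\<close> are treated one after another. Stability under passing to a subsequence keeps
  what has been achieved for the earlier indices.
\<close>

lemma common_subsequence:
  fixes \<Phi> :: "'i \<Rightarrow> (nat \<Rightarrow> nat) \<Rightarrow> bool"
  assumes "finite I"
    and refine: "\<And>p (\<psi> :: nat \<Rightarrow> nat). p \<in> I \<Longrightarrow> strict_mono \<psi> \<Longrightarrow>
      \<exists>\<phi> :: nat \<Rightarrow> nat. strict_mono \<phi> \<and> \<Phi> p (\<psi> \<circ> \<phi>)"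
    and stable: "\<And>p \<psi> (\<phi> :: nat \<Rightarrow> nat). p \<in> I \<Longrightarrow> \<Phi> p \<psi> \<Longrightarrow> strict_mono \<phi> \<Longrightarrow> \<Phi> p (\<psi> \<circ> \<phi>)"
  obtains \<phi> where "strict_mono \<phi>" "\<And>p. p \<in> I \<Longrightarrow> \<Phi> p \<phi>"
proof -
  have "\<exists>\<phi>. strict_mono \<phi> \<and> (\<forall>p\<in>I. \<Phi> p \<phi>)"
    using assms
  proof (induction I rule: finite_induct)
    case empty
    show ?case by (auto intro!: exI[of _ id] simp: strict_mono_def)
  next
    case (insert p I)
    have "\<exists>\<phi>. strict_mono \<phi> \<and> (\<forall>q\<in>I. \<Phi> q \<phi>)"
      by (rule insert.IH) (blast intro: insert.prems)+
    then obtain \<psi> where \<psi>: "strict_mono \<psi>" "\<forall>q\<in>I. \<Phi> q \<psi>" by blast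
    obtain \<phi> :: "nat \<Rightarrow> nat" where \<phi>: "strict_mono \<phi>" "\<Phi> p (\<psi> \<circ> \<phi>)"
      using insert.prems(1)[OF insertI1 \<psi>(1)] by blast
    have "\<forall>q\<in>I. \<Phi> q (\<psi> \<circ> \<phi>)"
      using insert.prems(2) \<psi>(2) \<phi>(1) by blast
    with \<psi>(1) \<phi> show ?case
      using strict_mono_o by blast
  qed
  then show thesis using that by blast
qed

text \<open>Dickson's lemma: all coordinates increase weakly along a common subsequence.\<close>

lemma almost_full_pointwise:
  assumes "finite Q"
  shows "almost_full_on (\<lambda>u v. \<forall>q\<in>Q. u q \<le> v q) (UNIV :: ('q \<Rightarrow> nat) set)"
proof (unfold almost_full_on_def, intro allI impI)
  fix f :: "nat \<Rightarrow> 'q \<Rightarrow> nat"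
  obtain \<phi> :: "nat \<Rightarrow> nat" where \<phi>: "strict_mono \<phi>" "\<And>q. q \<in> Q \<Longrightarrow> \<forall>i j. i < j \<longrightarrow> f (\<phi> i) q \<le> f (\<phi> j) q"
    using assms
  proof (rule common_subsequence[where \<Phi> = "\<lambda>q \<phi>. \<forall>i j. i < j \<longrightarrow> f (\<phi> i) q \<le> f (\<phi> j) q"])
    fix q and \<psi> :: "nat \<Rightarrow> nat"
    show "\<exists>\<phi> :: nat \<Rightarrow> nat. strict_mono \<phi> \<and> (\<forall>i j. i < j \<longrightarrow> f ((\<psi> \<circ> \<phi>) i) q \<le> f ((\<psi> \<circ> \<phi>) j) q)"
      by (rule almost_full_subsequence[OF almost_full_nat_le, of "\<lambda>i. f (\<psi> i) q"]) auto
  next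
    fix q and \<psi> \<phi> :: "nat \<Rightarrow> nat"
    assume "\<forall>i j. i < j \<longrightarrow> f (\<psi> i) q \<le> f (\<psi> j) q" "strict_mono \<phi>"
    then show "\<forall>i j. i < j \<longrightarrow> f ((\<psi> \<circ> \<phi>) i) q \<le> f ((\<psi> \<circ> \<phi>) j) q"
      by (simp add: strict_mono_def)
  qed blast
  then show "\<exists>i j. i < j \<and> (\<forall>q\<in>Q. f i q \<le> f j q)"
    by (intro exI[of _ "\<phi> 0"] exI[of _ "\<phi> 1"]) (simp add: strict_mono_def)
qed

lemma almost_full_prod:
  assumes "almost_full_on P S" "almost_full_on Q T"
  shows "almost_full_on (\<lambda>(a, b) (a', b'). P a a' \<and> Q b b') (S \<times> T)"
proof (unfold almost_full_on_def, intro allI impI)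
  fix f :: "nat \<Rightarrow> 'a \<times> 'b" assume f: "\<forall>i. f i \<in> S \<times> T"
  obtain \<phi> :: "nat \<Rightarrow> nat" where \<phi>: "strict_mono \<phi>"
    "\<And>i j. i < j \<Longrightarrow> P (fst (f (\<phi> i))) (fst (f (\<phi> j)))"
    by (rule almost_full_subsequence[OF assms(1), of "\<lambda>i. fst (f i)"])
      (use f in \<open>auto simp: mem_Times_iff\<close>)
  obtain i j where "i < j" "Q (snd (f (\<phi> i))) (snd (f (\<phi> j)))"
    by (rule almost_full_onD[OF assms(2), of "\<lambda>i. snd (f (\<phi> i))"])
      (use f in \<open>auto simp: mem_Times_iff\<close>)
  with \<phi> show "\<exists>i j. i < j \<and> (case f i of (a, b) \<Rightarrow> \<lambda>(a', b'). P a a' \<and> Q b b') (f j)"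
    by (intro exI[of _ "\<phi> i"] exI[of _ "\<phi> j"]) (auto simp: strict_mono_def case_prod_beta)
qed

text \<open>
  The minimal bad sequence argument of Nash-Williams: build a bad sequence \<open>g\<close> whose terms are
  chosen one after another, each of minimal length among the bad sequences with the same beginning.
  Along a subsequence whose heads increase, removing the heads would give a bad sequence with the
  same beginning and a shorter next term.
\<close>

theorem higman:
  assumes "almost_full_on P S"
  shows "almost_full_on (list_emb P) (lists S)"
proof (rule ccontr)
  define bad :: "(nat \<Rightarrow> 'a list) \<Rightarrow> bool" where
    "bad f \<longleftrightarrow> (\<forall>i. f i \<in> lists S) \<and> (\<forall>i j. i < j \<longrightarrow> \<not> list_emb P (f i) (f j))" for f
  define minimal :: "(nat \<Rightarrow> 'a list) \<Rightarrow> nat \<Rightarrow> 'a list \<Rightarrow> bool" where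
    "minimal g n r \<longleftrightarrow> (\<exists>f. bad f \<and> (\<forall>i<n. f i = g i) \<and> f n = r) \<and>
      (\<forall>f. bad f \<longrightarrow> (\<forall>i<n. f i = g i) \<longrightarrow> length r \<le> length (f n))" for g n r
  assume "\<not> almost_full_on (list_emb P) (lists S)"
  then obtain f0 where f0: "bad f0"
    unfolding almost_full_on_def bad_def by blast
  have "\<exists>g. \<forall>n. minimal g n (g n)"
  proof (rule dependent_wellorder_choice[where P = minimal])
    fix r and f g :: "nat \<Rightarrow> 'a list" and n :: nat
    assume "\<And>m. m < n \<Longrightarrow> f m = g m"
    then show "minimal f n r = minimal g n r" by (simp add: minimal_def)
  next
    fix n :: nat and g assume prev: "\<And>m. m < n \<Longrightarrow> minimal g m (g m)"
    define E where "E = {f. bad f \<and> (\<forall>i<n. f i = g i)}"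
    have "E \<noteq> {}"
    proof (cases n)
      case 0
      then show ?thesis using f0 by (auto simp: E_def)
    next
      case (Suc m)
      then obtain f where "bad f" "\<forall>i<m. f i = g i" "f m = g m"
        using prev[of m] by (auto simp: minimal_def)
      then show ?thesis using Suc by (auto simp: E_def less_Suc_eq)
    qed
    then obtain f where "f \<in> E" "\<And>f'. f' \<in> E \<Longrightarrow> length (f n) \<le> length (f' n)"
      using exists_least_iff[of "\<lambda>l. \<exists>f\<in>E. l = length (f n)"] by (metis ex_in_conv not_le_imp_less)
    then have "minimal g n (f n)"
      by (auto simp: minimal_def E_def)
    then show "\<exists>r. minimal g n r" ..
  qed
  then obtain g where g: "\<And>n. minimal g n (g n)" by blast
  have bad_g: "bad g"
    unfolding bad_def
  proof (intro conjI allI impI)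
    fix i show "g i \<in> lists S"
      using g[of i] unfolding minimal_def bad_def by metis
  next
    fix i j :: nat assume "i < j"
    then show "\<not> list_emb P (g i) (g j)"
      using g[of j] unfolding minimal_def bad_def by metis
  qed
  have ne: "g i \<noteq> []" for i
    using bad_g unfolding bad_def by (metis lessI list_emb_Nil)
  have inS: "g i \<in> lists S" for i using bad_g by (simp add: bad_def)
  have hd_in: "hd (g i) \<in> S" for i
    using inS[of i] ne[of i] by (metis in_listsD list.set_sel(1))
  have tl_in: "tl (g i) \<in> lists S" for i
    using inS[of i] ne[of i] by (auto dest: list.set_sel(2))
  obtain \<phi> :: "nat \<Rightarrow> nat" where \<phi>: "strict_mono \<phi>"
    "\<And>i j. i < j \<Longrightarrow> P (hd (g (\<phi> i))) (hd (g (\<phi> j)))"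
    by (rule almost_full_subsequence[OF assms, of "\<lambda>i. hd (g i)"]) (auto simp: hd_in)
  define f where "f i = (if i < \<phi> 0 then g i else tl (g (\<phi> (i - \<phi> 0))))" for i
  have lift: "list_emb P xs (g i)" if "list_emb P xs (tl (g i))" for xs i
    using list_emb_Cons[OF that, of "hd (g i)"] ne[of i] by simp
  have "bad f"
    unfolding bad_def
  proof (intro conjI allI impI)
    fix i show "f i \<in> lists S" by (simp add: f_def inS tl_in)
  next
    fix i j :: nat assume ij: "i < j"
    have no: "\<not> list_emb P (g a) (g b)" if "a < b" for a b
      using bad_g that by (simp add: bad_def)
    consider "j < \<phi> 0" | "i < \<phi> 0" "\<not> j < \<phi> 0" | "\<not> i < \<phi> 0" using ij by linarith
    then show "\<not> list_emb P (f i) (f j)"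
    proof cases
      case 1
      then show ?thesis using ij no by (simp add: f_def)
    next
      case 2
      have "\<phi> 0 \<le> \<phi> (j - \<phi> 0)" using \<phi>(1) by (simp add: strict_mono_less_eq)
      then show ?thesis using 2 no[of i "\<phi> (j - \<phi> 0)"] lift by (auto simp: f_def)
    next
      case 3
      let ?a = "\<phi> (i - \<phi> 0)" and ?b = "\<phi> (j - \<phi> 0)"
      have lt: "i - \<phi> 0 < j - \<phi> 0" using 3 ij by linarith
      then have "?a < ?b" using \<phi>(1) by (simp add: strict_mono_def)
      then have "\<not> list_emb P (tl (g ?a)) (tl (g ?b))"
        using no[of ?a ?b] list_emb_Cons2[where P = P, OF \<phi>(2)[OF lt], of "tl (g ?a)" "tl (g ?b)"] ne by auto
      then show ?thesis using 3 ij by (simp add: f_def)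
    qed
  qed
  moreover have "\<forall>i<\<phi> 0. f i = g i" by (simp add: f_def)
  ultimately have "length (g (\<phi> 0)) \<le> length (f (\<phi> 0))"
    using g[of "\<phi> 0"] by (simp add: minimal_def)
  then show False using ne[of "\<phi> 0"] by (simp add: f_def flip: length_greater_0_conv)
qed

text \<open>
  The index map of an embedding of words. It is a map on all of \<open>nat\<close> so that strict monotonicity
  needs no side conditions; its values from \<open>length xs\<close> on are arbitrary.
\<close>

lemma list_emb_strict_mono:
  assumes "list_emb P xs ys"
  obtains h :: "nat \<Rightarrow> nat" where "strict_mono h"
    "\<And>i. i < length xs \<Longrightarrow> h i < length ys \<and> P (xs ! i) (ys ! h i)"
proof -
  have "\<exists>h :: nat \<Rightarrow> nat. strict_mono h \<and> (\<forall>i<length xs. h i < length ys \<and> P (xs ! i) (ys ! h i))"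
    using assms
  proof induction
    case (list_emb_Nil ys)
    show ?case by (auto intro!: exI[of _ id] simp: strict_mono_def)
  next
    case (list_emb_Cons xs ys y)
    then obtain h :: "nat \<Rightarrow> nat" where "strict_mono h"
      "\<forall>i<length xs. h i < length ys \<and> P (xs ! i) (ys ! h i)" by blast
    then show ?case
      by (intro exI[of _ "\<lambda>i. Suc (h i)"]) (auto simp: strict_mono_def)
  next
    case (list_emb_Cons2 x y xs ys)
    then obtain h :: "nat \<Rightarrow> nat" where h: "strict_mono h"
      "\<forall>i<length xs. h i < length ys \<and> P (xs ! i) (ys ! h i)" by blast
    have "strict_mono (case_nat 0 (\<lambda>i. Suc (h i)))"
      using h(1) by (auto simp: strict_mono_def split: nat.split)
    with h list_emb_Cons2.hyps show ?case
      by (intro exI[of _ "case_nat 0 (\<lambda>i. Suc (h i))"]) (auto simp: nth_Cons split: nat.split)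
  qed
  then show thesis using that by blast
qed

section \<open>Divisibility of good exponents\<close>

abbreviation entry :: "expo \<Rightarrow> nat \<Rightarrow> nat \<Rightarrow> nat \<Rightarrow> nat" where
  "entry A p l j \<equiv> Poly_Mapping.lookup A (p, l, j)"

abbreviation shift :: "(nat \<Rightarrow> nat) \<Rightarrow> expo \<Rightarrow> expo" where
  "shift \<pi> \<equiv> push (\<lambda>(p, l, j). (p, l, \<pi> j))"

definition row_sum :: "expo \<Rightarrow> nat \<Rightarrow> nat \<Rightarrow> nat" where
  "row_sum A p l = Sum_any (\<lambda>j. entry A p l j)"

definition col_sum :: "(nat \<Rightarrow> nat) \<Rightarrow> expo \<Rightarrow> nat \<Rightarrow> nat \<Rightarrow> nat" where
  "col_sum k A p j = (\<Sum>l<k p. entry A p l j)"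

text \<open>
  For good tuples this is the common value of the row sums, the number \<open>d\<^sub>p\<close>. Row \<open>0\<close> exists as
  \<open>1 \<le> k p\<close>. The difference \<open>row_degree A p - col_sum k A p j\<close> is called the slack of column \<open>j\<close>
  below.
\<close>

definition row_degree :: "expo \<Rightarrow> nat \<Rightarrow> nat" where
  "row_degree A p = row_sum A p 0"

definition good_divides :: "nat \<Rightarrow> (nat \<Rightarrow> nat) \<Rightarrow> expo \<Rightarrow> expo \<Rightarrow> bool" where
  "good_divides N k A B \<longleftrightarrow> (\<exists>\<pi> C. strict_mono \<pi> \<and> good N k C \<and> B = shift \<pi> A + C)"

lemma good_iff:
  assumes k: "\<forall>p<N. 1 \<le> k p"
  shows "good N k A \<longleftrightarrow>
     (\<forall>(p, l, j) \<in> Poly_Mapping.keys A. p < N \<and> l < k p) \<and>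
     (\<forall>p<N. (\<forall>l<k p. row_sum A p l = row_degree A p) \<and> (\<forall>j. col_sum k A p j \<le> row_degree A p))"
proof -
  have row0: "(\<exists>d. (\<forall>l<k p. row_sum A p l = d) \<and> (\<forall>j. col_sum k A p j \<le> d)) \<longleftrightarrow>
      (\<forall>l<k p. row_sum A p l = row_degree A p) \<and> (\<forall>j. col_sum k A p j \<le> row_degree A p)"
    if "p < N" for p
  proof
    assume "\<exists>d. (\<forall>l<k p. row_sum A p l = d) \<and> (\<forall>j. col_sum k A p j \<le> d)"
    then obtain d where d: "\<forall>l<k p. row_sum A p l = d" "\<forall>j. col_sum k A p j \<le> d" by blast
    have "0 < k p" using k that by fastforce
    with d(1) have "row_degree A p = d" by (simp add: row_degree_def)
    with d show "(\<forall>l<k p. row_sum A p l = row_degree A p) \<and> (\<forall>j. col_sum k A p j \<le> row_degree A p)"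
      by simp
  qed blast
  show ?thesis
    unfolding good_def row_sum_def[symmetric] col_sum_def[symmetric]
    by (intro conj_cong refl all_cong row0)
qed

lemma
  assumes "strict_mono \<pi>"
  shows entry_shift: "entry (shift \<pi> A) p l (\<pi> j) = entry A p l j"
    and entry_shift_outside: "i \<notin> range \<pi> \<Longrightarrow> entry (shift \<pi> A) p l i = 0"
proof -
  have "inj (\<lambda>(p :: nat, l :: nat, j). (p, l, \<pi> j))"
    using strict_mono_eq[OF assms] by (auto simp: inj_def)
  from lookup_push_inj[OF this, of A "(p, l, j)"]
  show "entry (shift \<pi> A) p l (\<pi> j) = entry A p l j" by simp
  show "i \<notin> range \<pi> \<Longrightarrow> entry (shift \<pi> A) p l i = 0"
    by (rule lookup_push_outside) auto
qed

lemma row_sum_add: "row_sum (A + B) p l = row_sum A p l + row_sum B p l"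
  by (simp add: row_sum_def lookup_add Sum_any.distrib[OF finite_row finite_row])

lemma row_sum_shift:
  assumes "strict_mono \<pi>"
  shows "row_sum (shift \<pi> A) p l = row_sum A p l"
proof -
  have eq: "{j. entry (shift \<pi> A) p l j \<noteq> 0} = \<pi> ` {j. entry A p l j \<noteq> 0}"
  proof (rule equalityI; rule subsetI)
    fix i assume i: "i \<in> {j. entry (shift \<pi> A) p l j \<noteq> 0}"
    then have "i \<in> range \<pi>" using entry_shift_outside[OF assms, of i A p l] by auto
    with i show "i \<in> \<pi> ` {j. entry A p l j \<noteq> 0}" by (auto simp: entry_shift[OF assms])
  qed (auto simp: entry_shift[OF assms])
  have "inj_on \<pi> {j. entry A p l j \<noteq> 0}"
    by (rule strict_mono_imp_inj_on[OF assms])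
  then show ?thesis
    by (simp only: row_sum_def Sum_any.expand_set eq sum.reindex o_def entry_shift[OF assms])
qed

lemma col_sum_add: "col_sum k (A + B) p j = col_sum k A p j + col_sum k B p j"
  by (simp add: col_sum_def lookup_add sum.distrib)

lemma col_sum_shift:
  assumes "strict_mono \<pi>"
  shows "col_sum k (shift \<pi> A) p (\<pi> j) = col_sum k A p j"
    and "i \<notin> range \<pi> \<Longrightarrow> col_sum k (shift \<pi> A) p i = 0"
  by (simp_all add: col_sum_def entry_shift[OF assms] entry_shift_outside[OF assms])

lemma col_sum_eq_0_iff: "col_sum k A p j = 0 \<longleftrightarrow> (\<forall>l<k p. entry A p l j = 0)"
  by (auto simp: col_sum_def)

text \<open>
  The quotient \<open>B - shift \<pi> A\<close> exists if the entries of \<open>A\<close> are dominated along \<open>\<pi>\<close>. Its row sums are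
  \<open>row_degree B p - row_degree A p\<close>, so its column sums are small enough if the slack does not shrink
  along \<open>\<pi>\<close> and the columns of \<open>B\<close> that \<open>\<pi>\<close> misses have slack at least \<open>row_degree A p\<close>.
\<close>

lemma good_dividesI:
  assumes k: "\<forall>p<N. 1 \<le> k p"
    and A: "good N k A" and B: "good N k B" and \<pi>: "strict_mono \<pi>"
    and entries: "\<And>p l j. p < N \<Longrightarrow> l < k p \<Longrightarrow> entry A p l j \<le> entry B p l (\<pi> j)"
    and slack: "\<And>p j. p < N \<Longrightarrow>
      row_degree A p + col_sum k B p (\<pi> j) \<le> row_degree B p + col_sum k A p j"
    and slack_outside: "\<And>p i. p < N \<Longrightarrow> i \<notin> range \<pi> \<Longrightarrow>
      row_degree A p + col_sum k B p i \<le> row_degree B p"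
  shows "good_divides N k A B"
proof -
  define C where "C = B - shift \<pi> A"
  have le: "entry (shift \<pi> A) p l j \<le> entry B p l j" for p l j
  proof (cases "j \<in> range \<pi> \<and> p < N \<and> l < k p")
    case True
    then show ?thesis using entries by (auto simp: entry_shift[OF \<pi>])
  next
    case False
    have "(p, l, i) \<notin> Poly_Mapping.keys A" if "\<not> (p < N \<and> l < k p)" for i
      using A that by (auto simp: good_def)
    with False have "entry (shift \<pi> A) p l j = 0"
      by (cases "j \<in> range \<pi>") (auto simp: entry_shift[OF \<pi>] entry_shift_outside[OF \<pi>] in_keys_iff)
    then show ?thesis by simp
  qed
  have B_eq: "B = shift \<pi> A + C"
  proof (rule poly_mapping_eqI)
    fix v show "Poly_Mapping.lookup B v = Poly_Mapping.lookup (shift \<pi> A + C) v"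
      using le[of "fst v" "fst (snd v)" "snd (snd v)"] by (simp add: C_def lookup_add lookup_minus)
  qed
  have keys: "Poly_Mapping.keys C \<subseteq> Poly_Mapping.keys B"
    by (auto simp: C_def in_keys_iff lookup_minus)
  have rows: "row_sum B p l = row_sum A p l + row_sum C p l" for p l
    by (simp add: B_eq row_sum_add row_sum_shift[OF \<pi>])
  have cols: "col_sum k B p j = col_sum k (shift \<pi> A) p j + col_sum k C p j" for p j
    by (simp add: B_eq col_sum_add)
  have "good N k C"
    unfolding good_iff[OF k]
  proof (intro conjI allI impI)
    show "\<forall>(p, l, j)\<in>Poly_Mapping.keys C. p < N \<and> l < k p"
      using B keys unfolding good_def by blast
  next
    fix p l assume p: "p < N" and l: "l < k p"
    have "row_sum A p l = row_degree A p" "row_sum B p l = row_degree B p"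
      using A B p l by (auto simp: good_iff[OF k])
    then show "row_sum C p l = row_degree C p"
      using rows[of p l] rows[of p 0] by (simp add: row_degree_def)
  next
    fix p j assume p: "p < N"
    have "row_degree B p = row_degree A p + row_degree C p"
      using rows[of p 0] by (simp add: row_degree_def)
    moreover have "row_degree A p + col_sum k C p j \<le> row_degree B p"
    proof (cases "j \<in> range \<pi>")
      case True
      then obtain i where "j = \<pi> i" by blast
      with slack[OF p, of i] cols[of p j] show ?thesis by (simp add: col_sum_shift[OF \<pi>])
    next
      case False
      with slack_outside[OF p, of j] cols[of p j] show ?thesis by (simp add: col_sum_shift[OF \<pi>])
    qed
    ultimately show "col_sum k C p j \<le> row_degree C p" by simp
  qed
  with B_eq \<pi> show ?thesis unfolding good_divides_def by blast
qed

text \<open>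
  A sequence of natural numbers has a constant subsequence if it is bounded and a subsequence that
  at least doubles in every step if it is not.
\<close>

lemma constant_or_doubling_subsequence:
  fixes d :: "nat \<Rightarrow> nat"
  obtains \<phi> :: "nat \<Rightarrow> nat" where "strict_mono \<phi>"
    "(\<forall>i j. i < j \<longrightarrow> d (\<phi> i) = d (\<phi> j)) \<or> (\<forall>i j. i < j \<longrightarrow> 2 * d (\<phi> i) \<le> d (\<phi> j))"
proof -
  obtain \<phi> :: "nat \<Rightarrow> nat" where \<phi>: "strict_mono \<phi>"
    "(\<forall>i j. i < j \<longrightarrow> 2 * d (\<phi> i) \<le> d (\<phi> j)) \<or> (\<forall>i j. i < j \<longrightarrow> \<not> 2 * d (\<phi> i) \<le> d (\<phi> j))"
    by (rule homogeneous_subsequence[where f = d and P = "\<lambda>x y. 2 * x \<le> y"])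
  show thesis
  proof (cases "\<forall>i j. i < j \<longrightarrow> 2 * d (\<phi> i) \<le> d (\<phi> j)")
    case True
    with \<phi>(1) show thesis by (intro that) auto
  next
    case False
    with \<phi>(2) have "d (\<phi> (Suc i)) \<in> {..2 * d (\<phi> 0)}" for i
      using zero_less_Suc[of i] by (metis atMost_iff nat_le_linear)
    then obtain \<psi> :: "nat \<Rightarrow> nat" where \<psi>: "strict_mono \<psi>"
      "\<And>i j. i < j \<Longrightarrow> d (\<phi> (Suc (\<psi> i))) = d (\<phi> (Suc (\<psi> j)))"
      by (rule almost_full_subsequence[OF finite_almost_full[OF finite_atMost],
          where f = "\<lambda>i. d (\<phi> (Suc i))"]) blast
    have "strict_mono (\<lambda>i. \<phi> (Suc (\<psi> i)))"
      using \<phi>(1) \<psi>(1) by (simp add: strict_mono_def)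
    with \<psi>(2) show thesis by (intro that[of "\<lambda>i. \<phi> (Suc (\<psi> i))"]) auto
  qed
qed

text \<open>
  The columns of \<open>A i\<close> whose slack is less than the degree of some earlier \<open>A i'\<close>. All others have
  enough slack to be missed by a map \<open>\<pi>\<close> as in \<open>good_dividesI\<close>.
\<close>

definition tight_columns :: "(nat \<Rightarrow> nat) \<Rightarrow> (nat \<Rightarrow> expo) \<Rightarrow> nat \<Rightarrow> nat \<Rightarrow> nat set" where
  "tight_columns k A p i =
     {j. \<exists>i'<i. row_degree (A i) p < row_degree (A i') p + col_sum k (A i) p j}"

lemma finite_nonzero_columns: "finite {j. col_sum k A p j \<noteq> 0}"
proof (rule finite_subset)
  show "{j. col_sum k A p j \<noteq> 0} \<subseteq> (\<Union>l<k p. {j. entry A p l j \<noteq> 0})"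
    by (auto simp: col_sum_eq_0_iff)
qed (intro finite_UN_I finite_lessThan finite_row)

lemma sum_col_sum:
  assumes k: "\<forall>p<N. 1 \<le> k p" and A: "good N k A" and p: "p < N"
    and J: "finite J" "{j. col_sum k A p j \<noteq> 0} \<subseteq> J"
  shows "(\<Sum>j\<in>J. col_sum k A p j) = k p * row_degree A p"
proof -
  have "(\<Sum>j\<in>J. entry A p l j) = row_degree A p" if "l < k p" for l
  proof -
    have "{j. entry A p l j \<noteq> 0} \<subseteq> J"
      using J(2) that by (auto simp: col_sum_eq_0_iff)
    then have "row_sum A p l = (\<Sum>j\<in>J. entry A p l j)"
      unfolding row_sum_def by (rule Sum_any.expand_superset[OF J(1)])
    with A p that show ?thesis by (simp add: good_iff[OF k])
  qed
  then show ?thesis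
    unfolding col_sum_def by (subst sum.swap) simp
qed

text \<open>
  The column sums add up to \<open>k p * row_degree A p\<close>, so at most \<open>k p * c\<close> of the nonzero ones
  can reach \<open>row_degree A p / c\<close>.
\<close>

lemma card_columns_le:
  assumes k: "\<forall>p<N. 1 \<le> k p" and A: "good N k A" and p: "p < N"
    and J: "\<And>j. j \<in> J \<Longrightarrow> row_degree A p \<le> c * col_sum k A p j \<and> 0 < col_sum k A p j"
  shows "finite J \<and> card J \<le> k p * c"
proof
  let ?Z = "{j. col_sum k A p j \<noteq> 0}"
  have sub: "J \<subseteq> ?Z" using J by auto
  show fin: "finite J" by (rule finite_subset[OF sub finite_nonzero_columns])
  show "card J \<le> k p * c"
  proof (cases "J = {}")
    case False
    then obtain j where "j \<in> J" by auto
    have "col_sum k A p j \<le> row_degree A p" using A p by (simp add: good_iff[OF k])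
    with J[OF \<open>j \<in> J\<close>] have pos: "0 < row_degree A p" by linarith
    have "card J * row_degree A p = (\<Sum>j\<in>J. row_degree A p)" by simp
    also have "\<dots> \<le> (\<Sum>j\<in>J. c * col_sum k A p j)" by (rule sum_mono) (use J in blast)
    also have "\<dots> \<le> (\<Sum>j\<in>?Z. c * col_sum k A p j)"
      by (rule sum_mono2[OF finite_nonzero_columns sub]) simp
    also have "\<dots> = c * (k p * row_degree A p)"
      using sum_col_sum[OF k A p finite_nonzero_columns subset_refl] by (simp flip: sum_distrib_left)
    also have "\<dots> = (k p * c) * row_degree A p" by simp
    finally show ?thesis using pos by simp
  qed simp
qed

text \<open>
  If the degree is constant, then tight columns are nonzero, and there are at most \<open>k p\<close> times the
  degree of those. If it doubles in every step, then a tight column has a sum of more than half the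
  degree, and there are at most \<open>2 * k p\<close> of those.
\<close>

lemma tight_columns_bounded_subsequence:
  assumes k: "\<forall>p<N. 1 \<le> k p" and A: "\<And>i. good N k (A i)" and p: "p < N"
  obtains \<phi> :: "nat \<Rightarrow> nat" and K where "strict_mono \<phi>"
    "\<And>i. finite (tight_columns k (A \<circ> \<phi>) p i) \<and> card (tight_columns k (A \<circ> \<phi>) p i) \<le> K"
proof -
  obtain \<phi> :: "nat \<Rightarrow> nat" where \<phi>: "strict_mono \<phi>"
    "(\<forall>i j. i < j \<longrightarrow> row_degree (A (\<phi> i)) p = row_degree (A (\<phi> j)) p) \<or>
     (\<forall>i j. i < j \<longrightarrow> 2 * row_degree (A (\<phi> i)) p \<le> row_degree (A (\<phi> j)) p)"
    by (rule constant_or_doubling_subsequence[where d = "\<lambda>i. row_degree (A i) p"])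
  from \<phi>(2) show thesis
  proof
    assume const: "\<forall>i j. i < j \<longrightarrow> row_degree (A (\<phi> i)) p = row_degree (A (\<phi> j)) p"
    define d where "d = row_degree (A (\<phi> 0)) p"
    have d: "row_degree (A (\<phi> i)) p = d" for i
      using const[rule_format, of 0 i] by (cases "i = 0") (simp_all add: d_def)
    have bound: "finite (tight_columns k (A \<circ> \<phi>) p i) \<and> card (tight_columns k (A \<circ> \<phi>) p i) \<le> k p * d" for i
    proof (rule card_columns_le[OF k A[of "\<phi> i"] p])
      fix j assume "j \<in> tight_columns k (A \<circ> \<phi>) p i"
      then have "0 < col_sum k (A (\<phi> i)) p j" by (auto simp: tight_columns_def d)
      then show "row_degree (A (\<phi> i)) p \<le> d * col_sum k (A (\<phi> i)) p j \<and>
          0 < col_sum k (A (\<phi> i)) p j"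
        by (simp add: d)
    qed
    show thesis by (rule that[OF \<phi>(1) bound])
  next
    assume double: "\<forall>i j. i < j \<longrightarrow> 2 * row_degree (A (\<phi> i)) p \<le> row_degree (A (\<phi> j)) p"
    have bound: "finite (tight_columns k (A \<circ> \<phi>) p i) \<and> card (tight_columns k (A \<circ> \<phi>) p i) \<le> k p * 2" for i
    proof (rule card_columns_le[OF k A[of "\<phi> i"] p])
      fix j assume "j \<in> tight_columns k (A \<circ> \<phi>) p i"
      then obtain i' where "i' < i"
        "row_degree (A (\<phi> i)) p < row_degree (A (\<phi> i')) p + col_sum k (A (\<phi> i)) p j"
        by (auto simp: tight_columns_def)
      moreover from double this(1) have "2 * row_degree (A (\<phi> i')) p \<le> row_degree (A (\<phi> i)) p"
        by blast
      ultimately show "row_degree (A (\<phi> i)) p \<le> 2 * col_sum k (A (\<phi> i)) p j \<and>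
          0 < col_sum k (A (\<phi> i)) p j"
        by linarith
    qed
    show thesis by (rule that[OF \<phi>(1) bound])
  qed
qed

lemma tight_columns_subsequence:
  assumes "strict_mono \<phi>"
  shows "tight_columns k (A \<circ> \<phi>) p i \<subseteq> tight_columns k A p (\<phi> i)"
proof
  fix j assume "j \<in> tight_columns k (A \<circ> \<phi>) p i"
  then obtain i' where "i' < i"
    "row_degree (A (\<phi> i)) p < row_degree (A (\<phi> i')) p + col_sum k (A (\<phi> i)) p j"
    by (auto simp: tight_columns_def)
  then show "j \<in> tight_columns k A p (\<phi> i)"
    using strict_monoD[OF assms] unfolding tight_columns_def by blast
qed

text \<open>
  Pass to a subsequence with a constant number of tight columns. Reading a tuple as the word of its
  columns, Higman's lemma gives a map \<open>h\<close> that does not decrease entries and slack and that maps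
  tight columns to tight ones and the others to others.
  Since both tuples have equally many tight columns, \<open>h\<close> misses none of them, which is what
  \<open>good_dividesI\<close> asks for.
\<close>

theorem almost_full_good_divides:
  assumes k: "\<forall>p<N. 1 \<le> k p"
  shows "almost_full_on (good_divides N k) {A. good N k A}"
proof (unfold almost_full_on_def, intro allI impI)
  fix A0 :: "nat \<Rightarrow> expo" assume A0: "\<forall>i. A0 i \<in> {A. good N k A}"
  define bounded where "bounded p \<phi> \<longleftrightarrow>
      (\<exists>K. \<forall>i. finite (tight_columns k (A0 \<circ> \<phi>) p i) \<and> card (tight_columns k (A0 \<circ> \<phi>) p i) \<le> K)"
    for p \<phi>
  obtain \<phi> where \<phi>: "strict_mono \<phi>" "\<And>p. p \<in> {..<N} \<Longrightarrow> bounded p \<phi>"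
  proof (rule common_subsequence[of "{..<N}" bounded])
    fix p and \<psi> :: "nat \<Rightarrow> nat" assume "p \<in> {..<N}"
    then show "\<exists>\<phi>. strict_mono \<phi> \<and> bounded p (\<psi> \<circ> \<phi>)"
      using tight_columns_bounded_subsequence[OF k, where A = "A0 \<circ> \<psi>" and p = p] A0
      unfolding bounded_def o_assoc
      by (metis comp_apply lessThan_iff mem_Collect_eq)
  next
    fix p and \<psi> \<phi> :: "nat \<Rightarrow> nat"
    assume "bounded p \<psi>" "strict_mono \<phi>"
    then show "bounded p (\<psi> \<circ> \<phi>)"
      using tight_columns_subsequence[of \<phi> k "A0 \<circ> \<psi>" p]
      unfolding bounded_def o_assoc by (meson card_mono finite_subset le_trans)
  qed auto
  define A where "A = A0 \<circ> \<phi>"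
  have good_A: "good N k (A i)" for i using A0 by (simp add: A_def)
  define tight where "tight i = (\<Union>p<N. tight_columns k A p i)" for i
  have fin_tight: "finite (tight i)" for i
    using \<phi>(2) by (auto simp: tight_def bounded_def A_def)
  obtain K where K: "\<And>p i. p < N \<Longrightarrow> card (tight_columns k A p i) \<le> K p"
    using \<phi>(2) unfolding bounded_def A_def by (metis lessThan_iff)
  have "card (tight i) \<in> {..\<Sum>p<N. K p}" for i
    unfolding tight_def atMost_iff by (rule order_trans[OF card_UN_le]) (auto intro!: sum_mono K)
  then obtain \<chi> :: "nat \<Rightarrow> nat" where \<chi>: "strict_mono \<chi>"
    "\<And>i j. i < j \<Longrightarrow> card (tight (\<chi> i)) = card (tight (\<chi> j))"
    by (rule almost_full_subsequence[OF finite_almost_full[OF finite_atMost], 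
        where f = "\<lambda>i. card (tight i)"]) blast
  \<comment> \<open>The letter of a column records its entries, its slack (at \<open>l = k p\<close>) and whether it is tight.\<close>
  define column where "column i j = (\<lambda>(p, l). if l < k p then entry (A i) p l j
      else row_degree (A i) p - col_sum k (A i) p j)" for i j
  define letter where "letter i j = (j \<in> tight i, column i j)" for i j
  have "\<exists>L. \<forall>j\<ge>L. j \<notin> tight i \<and> (\<forall>p<N. col_sum k (A i) p j = 0)" for i
  proof -
    let ?J = "tight i \<union> (\<Union>p<N. {j. col_sum k (A i) p j \<noteq> 0})"
    have fin: "finite ?J" 
      by (intro finite_UnI finite_UN_I finite_lessThan fin_tight finite_nonzero_columns)
    have "j \<notin> ?J" if "Suc (Max ?J) \<le> j" for j
      using Max_ge[OF fin, of j] that by linarith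
    then show ?thesis by (intro exI[of _ "Suc (Max ?J)"]) blast
  qed
  then obtain L where L: "\<And>i j. L i \<le> j \<Longrightarrow> j \<notin> tight i"
    "\<And>i j p. L i \<le> j \<Longrightarrow> p < N \<Longrightarrow> col_sum k (A i) p j = 0"
    by metis
  \<comment> \<open>Beyond \<open>L i\<close> all columns of \<open>A i\<close> are zero and not tight, so the word of \<open>A i\<close> stops there.\<close>
  define word where "word i = map (letter i) [0..<L i]" for i
  \<comment> \<open>The last row index \<open>k p\<close> is the one that holds the slack.\<close>
  define Q where "Q = (SIGMA p:{..<N}. {..k p})"
  let ?le = "\<lambda>(b :: bool, u) (b', u'). b = b' \<and> (\<forall>q\<in>Q. u q \<le> (u' q :: nat))"
  have "almost_full_on (list_emb ?le) (lists (UNIV \<times> UNIV))"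
    by (intro higman almost_full_prod finite_almost_full almost_full_pointwise) (simp_all add: Q_def)
  then obtain a b where "a < b" and emb: "list_emb ?le (word (\<chi> a)) (word (\<chi> b))"
    by (rule almost_full_onD[where f = "\<lambda>i. word (\<chi> i)"]) auto
  define i j where "i = \<chi> a" and "j = \<chi> b"
  have ij: "i < j" using \<chi>(1) \<open>a < b\<close> by (simp add: i_def j_def strict_mono_def)
  have card_eq: "card (tight i) = card (tight j)" using \<chi>(2) \<open>a < b\<close> by (simp add: i_def j_def)
  obtain h :: "nat \<Rightarrow> nat" where h: "strict_mono h"
    and h_word: "\<And>t. t < length (word i) \<Longrightarrow>
      h t < length (word j) \<and> ?le (word i ! t) (word j ! h t)"
    using emb unfolding i_def j_def by (rule list_emb_strict_mono) blast
  have h_lt: "h t < L j" and h_le: "?le (letter i t) (letter j (h t))" if "t < L i" for t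
  proof -
    show lt: "h t < L j" using h_word[of t] that by (simp add: word_def)
    show "?le (letter i t) (letter j (h t))" using h_word[of t] that lt by (simp add: word_def)
  qed
  have tight_iff: "t \<in> tight i \<longleftrightarrow> h t \<in> tight j"
    and column_le: "q \<in> Q \<Longrightarrow> column i t q \<le> column j (h t) q" if "t < L i" for t q
    using h_le[OF that] by (auto simp: letter_def)
  have tight_lt: "t < L i" if "t \<in> tight i" for t i
    using L(1)[of i t] that by (meson not_le)
  have tight_image: "h ` tight i = tight j"
  proof (rule card_subset_eq)
    show "h ` tight i \<subseteq> tight j" using tight_iff tight_lt by blast
    show "card (h ` tight i) = card (tight j)"
      using card_image[of h "tight i"] strict_mono_imp_inj_on[OF h] card_eq
      by simp
  qed (rule fin_tight)
  \<comment> \<open>The zero columns of \<open>A i\<close> after its word go to zero columns of \<open>A j\<close> after its word.\<close>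
  define \<pi> where "\<pi> t = (if t < L i then h t else L j + t)" for t
  have \<pi>: "strict_mono \<pi>"
  proof (rule strict_monoI)
    fix s t :: nat assume "s < t"
    then show "\<pi> s < \<pi> t"
      using h_lt[of s] strict_monoD[OF h, of s t] by (auto simp: \<pi>_def)
  qed
  have loose: "row_degree (A i) p + col_sum k (A j) p t \<le> row_degree (A j) p"
    if "t \<notin> tight j" "p < N" for t p
  proof (rule ccontr)
    assume "\<not> ?thesis"
    then have "t \<in> tight_columns k A p j"
      unfolding tight_columns_def not_le using ij by blast
    then show False using that by (auto simp: tight_def)
  qed
  have "good_divides N k (A i) (A j)"
  proof (rule good_dividesI[OF k good_A good_A \<pi>])
    fix p l t assume pl: "p < N" "l < k p"
    show "entry (A i) p l t \<le> entry (A j) p l (\<pi> t)"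
    proof (cases "t < L i")
      case True
      with pl column_le[OF True, of "(p, l)"] show ?thesis
        by (simp add: \<pi>_def Q_def column_def)
    next
      case False
      with pl L(2)[of i t p] show ?thesis by (simp add: col_sum_eq_0_iff)
    qed
  next
    fix p t assume p: "p < N"
    show "row_degree (A i) p + col_sum k (A j) p (\<pi> t) \<le> row_degree (A j) p + col_sum k (A i) p t"
    proof (cases "t < L i")
      case True
      have "col_sum k (A i) p t \<le> row_degree (A i) p" "col_sum k (A j) p (h t) \<le> row_degree (A j) p"
        using good_A p by (auto simp: good_iff[OF k])
      moreover have "row_degree (A i) p - col_sum k (A i) p t \<le> row_degree (A j) p - col_sum k (A j) p (h t)"
        using p column_le[OF True, of "(p, k p)"] by (simp add: Q_def column_def)
      ultimately show ?thesis using True by (simp add: \<pi>_def)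
    next
      case False
      then have "\<pi> t \<notin> tight j" by (intro L(1)) (simp add: \<pi>_def)
      from loose[OF this p] show ?thesis by simp
    qed
  next
    fix p t assume p: "p < N" and t: "t \<notin> range \<pi>"
    have "t \<notin> tight j"
    proof
      assume "t \<in> tight j"
      then obtain s where "s \<in> tight i" "t = h s" using tight_image by blast
      then have "t = \<pi> s" using tight_lt by (simp add: \<pi>_def)
      with t show False by blast
    qed
    from loose[OF this p]
    show "row_degree (A i) p + col_sum k (A j) p t \<le> row_degree (A j) p" .
  qed
  moreover have "\<phi> i < \<phi> j" using \<phi>(1) ij by (simp add: strict_mono_def)
  ultimately show "\<exists>i j. i < j \<and> good_divides N k (A0 i) (A0 j)"
    unfolding A_def by auto
qed

section \<open>Comparing exponents at the largest differing variable\<close>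

text \<open>
  The largest differing variable decides because shifting a monomial upwards must make it larger;
  with the smallest one it would become smaller.
\<close>

definition expo_less :: "('x::linorder \<Rightarrow>\<^sub>0 nat) \<Rightarrow> ('x \<Rightarrow>\<^sub>0 nat) \<Rightarrow> bool" (infix \<open>\<lessdot>\<close> 50) where
  "A \<lessdot> B \<longleftrightarrow> (\<exists>v. Poly_Mapping.lookup A v < Poly_Mapping.lookup B v \<and>
     (\<forall>w>v. Poly_Mapping.lookup A w = Poly_Mapping.lookup B w))"

lemma expo_less_irrefl: "\<not> A \<lessdot> A"
  by (simp add: expo_less_def)

lemma expo_less_trans:
  assumes "A \<lessdot> B" "B \<lessdot> C"
  shows "A \<lessdot> C"
proof -
  obtain u where u: "Poly_Mapping.lookup A u < Poly_Mapping.lookup B u"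
    "\<And>w. u < w \<Longrightarrow> Poly_Mapping.lookup A w = Poly_Mapping.lookup B w"
    using assms(1) by (auto simp: expo_less_def)
  obtain v where v: "Poly_Mapping.lookup B v < Poly_Mapping.lookup C v"
    "\<And>w. v < w \<Longrightarrow> Poly_Mapping.lookup B w = Poly_Mapping.lookup C w"
    using assms(2) by (auto simp: expo_less_def)
  consider "u < v" | "u = v" | "v < u" by (rule linorder_cases)
  then show ?thesis
  proof cases
    case 1
    then show ?thesis unfolding expo_less_def
      by (intro exI[of _ v]) (metis less_trans u(2) v)
  next
    case 2
    then show ?thesis unfolding expo_less_def
      by (intro exI[of _ v]) (metis less_trans u v)
  next
    case 3
    then show ?thesis unfolding expo_less_def
      by (intro exI[of _ u]) (metis less_trans u v(2))
  qed
qed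

lemma expo_less_linear:
  assumes "A \<noteq> B"
  shows "A \<lessdot> B \<or> B \<lessdot> A"
proof -
  let ?D = "{v. Poly_Mapping.lookup A v \<noteq> Poly_Mapping.lookup B v}"
  have "?D \<subseteq> Poly_Mapping.keys A \<union> Poly_Mapping.keys B" by (auto simp: in_keys_iff)
  then have fin: "finite ?D" by (rule finite_subset) simp
  have "?D \<noteq> {}" using assms by (auto simp: poly_mapping_eq_iff fun_eq_iff)
  then have in_D: "Max ?D \<in> ?D" by (intro Max_in fin)
  have "Poly_Mapping.lookup A w = Poly_Mapping.lookup B w" if "Max ?D < w" for w
    using Max_ge[OF fin, of w] that by (meson linorder_not_le mem_Collect_eq)
  then show ?thesis using in_D unfolding expo_less_def
    by (metis (mono_tags, lifting) linorder_neqE_nat mem_Collect_eq)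
qed

lemma expo_less_add: "A \<lessdot> B \<Longrightarrow> C + A \<lessdot> C + B"
  by (simp add: expo_less_def lookup_add)

lemma expo_less_push:
  assumes h: "strict_mono h" and "A \<lessdot> B"
  shows "push h A \<lessdot> push h B"
proof -
  have inj: "inj h" using h by (rule strict_mono_imp_inj_on)
  obtain v where v: "Poly_Mapping.lookup A v < Poly_Mapping.lookup B v"
    "\<And>w. v < w \<Longrightarrow> Poly_Mapping.lookup A w = Poly_Mapping.lookup B w"
    using assms(2) by (auto simp: expo_less_def)
  have "Poly_Mapping.lookup (push h A) w = Poly_Mapping.lookup (push h B) w" if "h v < w" for w
  proof (cases "w \<in> range h")
    case True
    then obtain u where "w = h u" by auto
    with that v(2)[of u] h show ?thesis by (simp add: lookup_push_inj[OF inj] strict_mono_less)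
  qed (simp add: lookup_push_outside)
  with v(1) show ?thesis
    unfolding expo_less_def by (intro exI[of _ "h v"]) (simp add: lookup_push_inj[OF inj])
qed

text \<open>
  If \<open>push h A + C\<close> were smaller because of the variable \<open>v\<close>, then \<open>h\<close> would move \<open>v\<close> upwards, where
  \<open>push h A + C\<close> and \<open>A\<close> agree, and so \<open>h v\<close> and then the whole orbit of \<open>v\<close> would occur in \<open>A\<close>.
\<close>

lemma expo_less_no_descent:
  assumes h: "strict_mono h" "\<And>x. x \<le> h x"
  shows "\<not> push h A + C \<lessdot> A"
proof
  have inj: "inj h" using h(1) by (rule strict_mono_imp_inj_on)
  assume "push h A + C \<lessdot> A"
  then obtain v where v:
    "Poly_Mapping.lookup (push h A) v + Poly_Mapping.lookup C v < Poly_Mapping.lookup A v"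
    "\<And>w. v < w \<Longrightarrow>
      Poly_Mapping.lookup (push h A) w + Poly_Mapping.lookup C w = Poly_Mapping.lookup A w"
    by (auto simp: expo_less_def lookup_add)
  have "h v \<noteq> v" using v(1) lookup_push_inj[OF inj, of A v] by auto
  then have lt: "v < h v" using h(2)[of v] by (simp add: order_less_le)
  let ?o = "\<lambda>n. (h ^^ n) v"
  have step: "?o n < ?o (Suc n)" for n
    by (induction n) (use lt h(1) in \<open>auto simp: strict_mono_less\<close>)
  then have sm: "strict_mono ?o" by (simp add: strict_mono_Suc_iff)
  have pos: "0 < Poly_Mapping.lookup A (?o n)" for n
  proof (induction n)
    case 0
    show ?case using v(1) by simp
  next
    case (Suc n)
    have "v < ?o (Suc n)" using strict_monoD[OF sm, of 0 "Suc n"] by simp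
    then have "Poly_Mapping.lookup (push h A) (?o (Suc n)) \<le> Poly_Mapping.lookup A (?o (Suc n))"
      using v(2)[of "?o (Suc n)"] by linarith
    with Suc show ?case by (simp add: lookup_push_inj[OF inj])
  qed
  then have "range ?o \<subseteq> Poly_Mapping.keys A" by (auto simp: in_keys_iff)
  then have "finite (range ?o)" by (rule finite_subset) simp
  then show False
    using strict_mono_imp_inj_on[OF sm] finite_imageD infinite_UNIV_nat by blast
qed

section \<open>Leading monomials\<close>

definition leading :: "(('x::linorder \<Rightarrow>\<^sub>0 nat) \<Rightarrow>\<^sub>0 'b::zero) \<Rightarrow> ('x \<Rightarrow>\<^sub>0 nat) \<Rightarrow> bool" where
  "leading f A \<longleftrightarrow> A \<in> Poly_Mapping.keys f \<and> (\<forall>B\<in>Poly_Mapping.keys f. B = A \<or> B \<lessdot> A)"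

lemma ex_leading:
  assumes "f \<noteq> 0"
  obtains A where "leading f A"
proof -
  have "asymp_on (Poly_Mapping.keys f) (\<lessdot>)"
    by (rule asymp_onI) (use expo_less_trans expo_less_irrefl in blast)
  moreover have "transp_on (Poly_Mapping.keys f) (\<lessdot>)"
    by (rule transp_onI) (rule expo_less_trans)
  moreover have "Poly_Mapping.keys f \<noteq> {}" using assms by simp
  ultimately obtain A where "A \<in> Poly_Mapping.keys f"
    "\<forall>B\<in>Poly_Mapping.keys f. B \<noteq> A \<longrightarrow> \<not> A \<lessdot> B"
    using Finite_Set.bex_max_element[OF finite_keys] by blast
  then have "leading f A" unfolding leading_def using expo_less_linear by blast
  then show thesis by (rule that)
qed

lemma leading_unique:
  assumes "leading f A" "leading f B"
  shows "A = B"
proof (rule ccontr)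
  assume "A \<noteq> B"
  with assms have "A \<lessdot> B" "B \<lessdot> A" by (auto simp: leading_def)
  then show False using expo_less_trans expo_less_irrefl by metis
qed

text \<open>
  Variables are ordered lexicographically as triples \<open>(p, l, j)\<close>.
\<close>

lemma strict_mono_shift_index:
  assumes "strict_mono \<pi>"
  shows "strict_mono (\<lambda>(p :: nat, l :: nat, j :: nat). (p, l, \<pi> j :: nat))"
  by (rule strict_monoI) (auto simp: less_prod_def' strict_mono_less[OF assms])

lemma shift_index_increasing:
  assumes "strict_mono \<pi>"
  shows "x \<le> (case x of (p :: nat, l :: nat, j :: nat) \<Rightarrow> (p, l, \<pi> j :: nat))"
  using strict_mono_imp_increasing[OF assms] by (cases x) (simp add: less_eq_prod_def)

text \<open>
  Multiplying by a term and shifting preserve the order of monomials, so the leading monomial of a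
  product \<open>a x\<^sup>C \<cdot> \<pi> f\<close> is read off from that of \<open>f\<close>. If \<open>a\<close> annihilates the leading coefficient, then
  \<open>D\<close> is only an upper bound for the monomials.
\<close>

lemma leading_monomial_times_shift:
  fixes f :: "expo \<Rightarrow>\<^sub>0 'a::{comm_ring, comm_monoid_mult}"
    and C :: expo and a :: 'a
  assumes \<pi>: "strict_mono \<pi>" and A: "leading f A"
  defines "T \<equiv> Poly_Mapping.single C a * inc_act \<pi> f" and "D \<equiv> shift \<pi> A + C"
  shows "Poly_Mapping.lookup T D = a * Poly_Mapping.lookup f A"
    and "\<And>B. B \<in> Poly_Mapping.keys T \<Longrightarrow> B = D \<or> B \<lessdot> D"
proof -
  have less: "C + shift \<pi> B \<lessdot> D" if "B \<in> Poly_Mapping.keys f" "B \<noteq> A" for B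
  proof -
    have "B \<lessdot> A" using A that by (auto simp: leading_def)
    from expo_less_add[OF expo_less_push[OF strict_mono_shift_index[OF \<pi>] this]]
    show ?thesis by (simp add: D_def add.commute)
  qed
  have T: "T = (\<Sum>B\<in>Poly_Mapping.keys f.
      Poly_Mapping.single (C + shift \<pi> B) (a * Poly_Mapping.lookup f B))"
    by (simp add: T_def inc_act_def push_def[of _ f] sum_distrib_left mult_single)
  have "Poly_Mapping.lookup T D =
      (\<Sum>B\<in>Poly_Mapping.keys f. if B = A then a * Poly_Mapping.lookup f B else 0)"
    unfolding T lookup_sum
  proof (rule sum.cong[OF refl])
    fix B assume B: "B \<in> Poly_Mapping.keys f"
    have "C + shift \<pi> B \<noteq> D" if "B \<noteq> A" using less[OF B that] expo_less_irrefl by metis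
    then show "Poly_Mapping.lookup (Poly_Mapping.single (C + shift \<pi> B) (a * Poly_Mapping.lookup f B)) D =
        (if B = A then a * Poly_Mapping.lookup f B else 0)"
      by (auto simp: lookup_single when_def D_def add.commute)
  qed
  also have "\<dots> = a * Poly_Mapping.lookup f A"
    using A by (simp add: leading_def)
  finally show "Poly_Mapping.lookup T D = a * Poly_Mapping.lookup f A" .
  fix B assume "B \<in> Poly_Mapping.keys T"
  then have "Poly_Mapping.lookup T B \<noteq> 0" by (simp add: in_keys_iff)
  then obtain B' where B': "B' \<in> Poly_Mapping.keys f"
    "Poly_Mapping.lookup (Poly_Mapping.single (C + shift \<pi> B') (a * Poly_Mapping.lookup f B')) B \<noteq> 0"
    unfolding T lookup_sum by (rule sum.not_neutral_contains_not_neutral)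
  then have "B = C + shift \<pi> B'" by (auto simp: lookup_single when_def split: if_splits)
  then show "B = D \<or> B \<lessdot> D"
    using less[OF B'(1)] by (cases "B' = A") (auto simp: D_def add.commute)
qed

text \<open>
  An infinite descent contains two terms of which the earlier one divides the later one, but
  divisors are never larger by \<open>expo_less_no_descent\<close>.
\<close>

lemma wfp_on_good:
  assumes k: "\<forall>p<N. 1 \<le> k p"
  shows "wfp_on {A. good N k A} (\<lessdot>)"
proof -
  let ?r = "{(A, B). A \<lessdot> B \<and> good N k A \<and> good N k B}"
  have "\<nexists>f. \<forall>i :: nat. (f (Suc i), f i) \<in> ?r"
  proof
    assume "\<exists>f. \<forall>i :: nat. (f (Suc i), f i) \<in> ?r"
    then obtain f :: "nat \<Rightarrow> expo" where f: "\<And>i. f (Suc i) \<lessdot> f i" "\<And>i. good N k (f i)" by blast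
    have desc: "f j \<lessdot> f i" if "i < j" for i j
      using that
    proof (induction rule: strict_inc_induct)
      case (base i)
      then show ?case using f(1)[of i] by simp
    next
      case (step i)
      then show ?case using f(1)[of i] expo_less_trans by blast
    qed
    obtain i j where ij: "i < j" "good_divides N k (f i) (f j)"
      by (rule almost_full_onD[OF almost_full_good_divides[OF k], where f = f]) (use f(2) in auto)
    then obtain \<pi> C where \<pi>: "strict_mono \<pi>" and f_j: "f j = shift \<pi> (f i) + C"
      unfolding good_divides_def by blast
    have "\<not> shift \<pi> (f i) + C \<lessdot> f i"
      by (rule expo_less_no_descent[OF strict_mono_shift_index[OF \<pi>] shift_index_increasing[OF \<pi>]])
    then show False using desc[OF ij(1)] f_j by simp
  qed
  then have "wf ?r" unfolding wf_iff_no_infinite_down_chain .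
  then have "wfp (\<lambda>A B. A \<lessdot> B \<and> good N k A \<and> good N k B)" by (rule wfp_def[THEN iffD2])
  then show ?thesis by (subst wfp_on_iff_wfp) (simp only: mem_Collect_eq)
qed

section \<open>Noetherian coefficients\<close>

definition linear_combinations :: "(nat \<Rightarrow> 'a::{comm_ring, comm_monoid_mult}) \<Rightarrow> nat \<Rightarrow> 'a set" where
  "linear_combinations r n = {x. \<exists>a. x = (\<Sum>i<n. a i * r i)}"

lemma linear_combinationsI: "x = (\<Sum>i<n. a i * r i) \<Longrightarrow> x \<in> linear_combinations r n"
  by (auto simp: linear_combinations_def)

lemma linear_combinationsE:
  assumes "x \<in> linear_combinations r n"
  obtains a where "x = (\<Sum>i<n. a i * r i)"
  using assms unfolding linear_combinations_def by blast

lemma ideal_linear_combinations: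
  fixes r :: "nat \<Rightarrow> 'a::{comm_ring, comm_monoid_mult}"
  shows "ideal (linear_combinations r n) coeff_ring"
proof -
  interpret R: cring "coeff_ring :: 'a ring" by (rule cring_coeff_ring)
  have uminus: "\<ominus>\<^bsub>coeff_ring\<^esub> x = - x" for x :: 'a
    by (rule R.minus_equality) (simp_all add: coeff_ring_def)
  show ?thesis
  proof (rule idealI)
    show "subgroup (linear_combinations r n) (add_monoid coeff_ring)"
    proof (rule subgroup.intro)
      fix x y assume "x \<in> linear_combinations r n" "y \<in> linear_combinations r n"
      then obtain a b where "x = (\<Sum>i<n. a i * r i)" "y = (\<Sum>i<n. b i * r i)"
        by (elim linear_combinationsE)
      then have "x + y = (\<Sum>i<n. (a i + b i) * r i)"
        by (simp add: distrib_right sum.distrib)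
      then have "x + y \<in> linear_combinations r n" by (rule linear_combinationsI)
      then show "x \<otimes>\<^bsub>add_monoid coeff_ring\<^esub> y \<in> linear_combinations r n"
        by (simp add: coeff_ring_def)
    next
      have "0 \<in> linear_combinations r n"
        by (rule linear_combinationsI[where a = "\<lambda>_. 0"]) simp
      then show "\<one>\<^bsub>add_monoid coeff_ring\<^esub> \<in> linear_combinations r n"
        by (simp add: coeff_ring_def)
    next
      fix x assume "x \<in> linear_combinations r n"
      then obtain a where "x = (\<Sum>i<n. a i * r i)" by (rule linear_combinationsE)
      then have "- x = (\<Sum>i<n. (- a i) * r i)" by (simp add: sum_negf)
      then have "- x \<in> linear_combinations r n" by (rule linear_combinationsI)
      then show "inv\<^bsub>add_monoid coeff_ring\<^esub> x \<in> linear_combinations r n"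
        by (simp only: uminus flip: a_inv_def)
    qed (simp add: coeff_ring_def)
  next
    fix x c assume "x \<in> linear_combinations r n"
    then obtain a where "x = (\<Sum>i<n. a i * r i)" by (rule linear_combinationsE)
    then have "c * x = (\<Sum>i<n. (c * a i) * r i)" by (simp add: sum_distrib_left mult.assoc)
    then have "c * x \<in> linear_combinations r n" by (rule linear_combinationsI)
    then show "c \<otimes>\<^bsub>coeff_ring\<^esub> x \<in> linear_combinations r n"
      "x \<otimes>\<^bsub>coeff_ring\<^esub> c \<in> linear_combinations r n"
      by (simp_all add: coeff_ring_def mult.commute[of x])
  qed (rule R.ring_axioms)
qed

text \<open>
  The ideals spanned by the first \<open>n\<close> terms form a chain, which therefore becomes stationary.
\<close>

lemma noetherian_sequence:
  fixes r :: "nat \<Rightarrow> 'a::{comm_ring, comm_monoid_mult}"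
  assumes "noetherian_ring (coeff_ring :: 'a ring)"
  obtains m a where "r m = (\<Sum>i<m. a i * r i)"
proof -
  interpret R: noetherian_ring "coeff_ring :: 'a ring" by (rule assms)
  let ?J = "linear_combinations r"
  have mono: "?J n \<subseteq> ?J m" if "n \<le> m" for n m
  proof
    fix x assume "x \<in> ?J n"
    then obtain a where "x = (\<Sum>i<n. a i * r i)" by (rule linear_combinationsE)
    also have "\<dots> = (\<Sum>i<m. (if i < n then a i else 0) * r i)"
      using that by (intro sum.mono_neutral_cong_left) auto
    finally show "x \<in> ?J m" by (rule linear_combinationsI)
  qed
  have "?J n \<subseteq> ?J m \<or> ?J m \<subseteq> ?J n" for n m
    using mono[of n m] mono[of m n] by linarith
  then have "subset.chain {I. ideal I (coeff_ring :: 'a ring)} (range ?J)"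
    unfolding subset_chain_def using ideal_linear_combinations[of r] by blast
  then have "\<Union>(range ?J) \<in> range ?J" by (intro R.ideal_chain_is_trivial) auto
  then obtain n where n: "\<Union>(range ?J) = ?J n" by (rule rangeE)
  have "r n = (\<Sum>i<Suc n. (if i = n then 1 else 0) * r i)" by simp
  then have "r n \<in> ?J (Suc n)" by (rule linear_combinationsI)
  then have "r n \<in> ?J n" unfolding n[symmetric] by (rule UN_I[OF UNIV_I])
  then show thesis by (rule linear_combinationsE) (rule that)
qed

section \<open>Ideals generated by orbits\<close>

lemma
  fixes J :: "(expo \<Rightarrow>\<^sub>0 'a::{comm_ring, comm_monoid_mult}) set"
  assumes "ideal J (good_ring N k)"
  shows good_ideal_zero: "0 \<in> J"
    and good_ideal_add: "x \<in> J \<Longrightarrow> y \<in> J \<Longrightarrow> x + y \<in> J"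
    and good_ideal_diff: "x \<in> J \<Longrightarrow> y \<in> J \<Longrightarrow> x - y \<in> J"
    and good_ideal_mult: "x \<in> J \<Longrightarrow> c \<in> carrier (good_ring N k) \<Longrightarrow> c * x \<in> J"
    and good_ideal_keys: "x \<in> J \<Longrightarrow> A \<in> Poly_Mapping.keys x \<Longrightarrow> good N k A"
proof -
  interpret S: cring "good_ring N k :: (expo \<Rightarrow>\<^sub>0 'a) ring" by (rule cring_good_ring)
  interpret J: ideal J "good_ring N k" by (rule assms)
  show "0 \<in> J" using J.zero_closed by (simp add: good_ring_def)
  show add: "x \<in> J \<Longrightarrow> y \<in> J \<Longrightarrow> x + y \<in> J" for x y
    using J.a_closed[of x y] by (simp add: good_ring_def)
  show "x \<in> J \<Longrightarrow> c \<in> carrier (good_ring N k) \<Longrightarrow> c * x \<in> J"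
    using J.I_l_closed[of x c] by (simp add: good_ring_def)
  show "x \<in> J \<Longrightarrow> A \<in> Poly_Mapping.keys x \<Longrightarrow> good N k A"
    using J.Icarr[of x] by (simp add: good_ring_def)
  assume x: "x \<in> J" and y: "y \<in> J"
  have "y \<in> carrier (good_ring N k)" using y by (rule J.Icarr)
  then have "\<ominus>\<^bsub>good_ring N k\<^esub> y = - y"
    by (intro S.minus_equality) (auto simp: good_ring_def)
  with J.a_inv_closed[OF y] add[OF x, of "- y"] show "x - y \<in> J" by simp
qed

lemma good_ideal_sum:
  assumes "ideal J (good_ring N k)" "\<And>i. i \<in> X \<Longrightarrow> f i \<in> J"
  shows "sum f X \<in> J"
  using assms(2)
proof (induction X rule: infinite_finite_induct)
  case (insert i X)
  then have "f i + sum f X \<in> J" by (intro good_ideal_add[OF assms(1)]) simp_all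
  with insert.hyps show ?case by simp
qed (simp_all add: good_ideal_zero[OF assms(1)])

definition orbit_ideal ::
    "nat \<Rightarrow> (nat \<Rightarrow> nat) \<Rightarrow> (expo \<Rightarrow>\<^sub>0 'a::{comm_ring, comm_monoid_mult}) set \<Rightarrow> (expo \<Rightarrow>\<^sub>0 'a) set"
  where "orbit_ideal N k F =
    Idl\<^bsub>good_ring N k\<^esub> (\<Union>f\<in>F. (\<lambda>\<pi>. inc_act \<pi> f) ` carrier Inc_monoid)"

lemma
  fixes F :: "(expo \<Rightarrow>\<^sub>0 'a::{comm_ring, comm_monoid_mult}) set"
  assumes "F \<subseteq> carrier (good_ring N k)"
  shows ideal_orbit_ideal: "ideal (orbit_ideal N k F) (good_ring N k)"
    and orbit_in_orbit_ideal: "f \<in> F \<Longrightarrow> strict_mono \<pi> \<Longrightarrow> inc_act \<pi> f \<in> orbit_ideal N k F"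
proof -
  interpret S: cring "good_ring N k :: (expo \<Rightarrow>\<^sub>0 'a) ring" by (rule cring_good_ring)
  have sub: "(\<Union>f\<in>F. (\<lambda>\<pi>. inc_act \<pi> f) ` carrier Inc_monoid) \<subseteq> carrier (good_ring N k)"
    using inc_act_good_ring[OF _ subsetD[OF assms]] by (auto simp: Inc_monoid_def)
  show "ideal (orbit_ideal N k F) (good_ring N k)"
    unfolding orbit_ideal_def by (rule S.genideal_ideal[OF sub])
  show "f \<in> F \<Longrightarrow> strict_mono \<pi> \<Longrightarrow> inc_act \<pi> f \<in> orbit_ideal N k F"
    unfolding orbit_ideal_def by (rule subsetD[OF S.genideal_self[OF sub]]) (auto simp: Inc_monoid_def)
qed

lemma orbit_ideal_subset:
  fixes I :: "(expo \<Rightarrow>\<^sub>0 'a::{comm_ring, comm_monoid_mult}) set"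
  assumes "ideal I (good_ring N k)" "\<And>\<pi> f. strict_mono \<pi> \<Longrightarrow> f \<in> I \<Longrightarrow> inc_act \<pi> f \<in> I" "F \<subseteq> I"
  shows "orbit_ideal N k F \<subseteq> I"
proof -
  interpret S: cring "good_ring N k :: (expo \<Rightarrow>\<^sub>0 'a) ring" by (rule cring_good_ring)
  show ?thesis
    unfolding orbit_ideal_def
    by (rule S.genideal_minimal[OF assms(1)]) (use assms(2,3) in \<open>auto simp: Inc_monoid_def\<close>)
qed

text \<open>
  If \<open>I\<close> were not generated by finitely many orbits, then one could choose \<open>f 0, f 1, \<dots>\<close> such that
  \<open>f n\<close> has the least leading monomial among the elements of \<open>I\<close> outside the ideal generated by the
  orbits of the earlier ones. Along some subsequence the leading monomials divide each other, and
  some leading coefficient \<open>c m\<close> is a linear combination of the preceding ones. Subtracting the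
  corresponding combination of multiples of shifts cancels the leading term of that element and
  contradicts its minimality.
\<close>

theorem stable_ideal_finitely_orbit_generated:
  fixes I :: "(expo \<Rightarrow>\<^sub>0 'a::{comm_ring, comm_monoid_mult}) set"
  assumes noeth: "noetherian_ring (coeff_ring :: 'a ring)" and k: "\<forall>p<N. 1 \<le> k p"
    and I: "ideal I (good_ring N k)"
    and stable: "\<And>\<pi> f. strict_mono \<pi> \<Longrightarrow> f \<in> I \<Longrightarrow> inc_act \<pi> f \<in> I"
  shows "\<exists>F \<subseteq> I. finite F \<and> I = orbit_ideal N k F"
proof (rule ccontr)
  assume contr: "\<not> ?thesis"
  interpret I: ideal I "good_ring N k" by (rule I)
  have I_carrier: "I \<subseteq> carrier (good_ring N k)" by (rule I.a_subset)
  define least where "least F r \<longleftrightarrow> r \<in> I - orbit_ideal N k F \<and>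
      (\<forall>g\<in>I - orbit_ideal N k F. \<forall>A B. leading r A \<longrightarrow> leading g B \<longrightarrow> \<not> B \<lessdot> A)" for F r
  have nonzero: "g \<noteq> 0" if "g \<notin> orbit_ideal N k F" "F \<subseteq> I" for g F
    using that good_ideal_zero[OF ideal_orbit_ideal[of F N k]] I_carrier by blast
  have ex_least: "\<exists>r. least F r" if F: "finite F" "F \<subseteq> I" for F
  proof -
    let ?L = "{A. \<exists>g\<in>I - orbit_ideal N k F. leading g A}"
    have "orbit_ideal N k F \<subseteq> I" by (rule orbit_ideal_subset[OF I stable F(2)])
    with contr F obtain g where g: "g \<in> I - orbit_ideal N k F" by blast
    then obtain A where "leading g A" using ex_leading nonzero[OF _ F(2)] by blast
    with g have "?L \<noteq> {}" by blast
    moreover have "?L \<subseteq> {A. good N k A}"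
      using good_ideal_keys[OF I] by (auto simp: leading_def)
    ultimately obtain A where A: "A \<in> ?L" "\<And>B. B \<lessdot> A \<Longrightarrow> B \<notin> ?L"
      using wfp_on_good[OF k, unfolded wfp_on_iff_ex_minimal] by meson
    then obtain r where "r \<in> I - orbit_ideal N k F" "leading r A" by blast
    with A(2) have "least F r" unfolding least_def using leading_unique by blast
    then show ?thesis ..
  qed
  define next_choice where "next_choice f n r \<longleftrightarrow> least (f ` {..<n}) r"
    for f :: "nat \<Rightarrow> expo \<Rightarrow>\<^sub>0 'a" and n r
  have "\<exists>f. \<forall>n. next_choice f n (f n)"
  proof (rule dependent_wellorder_choice[where P = next_choice])
    fix r and f g :: "nat \<Rightarrow> expo \<Rightarrow>\<^sub>0 'a" and n :: nat
    assume "\<And>m. m < n \<Longrightarrow> f m = g m"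
    then have "f ` {..<n} = g ` {..<n}" by (intro image_cong) auto
    then show "next_choice f n r = next_choice g n r" by (simp add: next_choice_def)
  next
    fix n :: nat and f assume "\<And>m. m < n \<Longrightarrow> next_choice f m (f m)"
    then have "f ` {..<n} \<subseteq> I" by (auto simp: next_choice_def least_def)
    then show "\<exists>r. next_choice f n r" unfolding next_choice_def by (intro ex_least) auto
  qed
  then obtain f where "\<forall>n. next_choice f n (f n)" ..
  then have f: "least (f ` {..<n}) (f n)" for n by (simp add: next_choice_def)
  have f_I: "f n \<in> I" and f_notin: "f n \<notin> orbit_ideal N k (f ` {..<n})" for n
    using f[of n] by (simp_all add: least_def)
  have sub: "f ` {..<n} \<subseteq> I" "f ` {..<n} \<subseteq> carrier (good_ring N k)" for n using f_I I_carrier by auto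
  have "\<exists>A. leading (f n) A" for n
    by (rule ex_leading[OF nonzero[OF f_notin sub(1)]]) (rule exI)
  then obtain A where A: "\<And>n. leading (f n) (A n)" by metis
  have "good N k (A n)" for n
    using good_ideal_keys[OF I f_I] A by (auto simp: leading_def)
  then have A_good: "A n \<in> {B. good N k B}" for n by simp
  obtain \<phi> :: "nat \<Rightarrow> nat" where \<phi>: "strict_mono \<phi>"
    "\<And>i j. i < j \<Longrightarrow> good_divides N k (A (\<phi> i)) (A (\<phi> j))"
    by (rule almost_full_subsequence[OF almost_full_good_divides[OF k], where f = A]) (use A_good in blast)+
  define c where "c i = Poly_Mapping.lookup (f (\<phi> i)) (A (\<phi> i))" for i
  obtain m a where c_m: "c m = (\<Sum>i<m. a i * c i)"
    by (rule noetherian_sequence[OF noeth])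
  have "\<exists>\<pi> C. i < m \<longrightarrow> strict_mono \<pi> \<and> good N k C \<and> A (\<phi> m) = shift \<pi> (A (\<phi> i)) + C" for i
    using \<phi>(2)[of i m] unfolding good_divides_def by blast
  then obtain \<pi> C where \<pi>C: "\<And>i. i < m \<Longrightarrow> strict_mono (\<pi> i)" "\<And>i. i < m \<Longrightarrow> good N k (C i)"
    "\<And>i. i < m \<Longrightarrow> A (\<phi> m) = shift (\<pi> i) (A (\<phi> i)) + C i"
    by metis
  define T where "T i = Poly_Mapping.single (C i) (a i) * inc_act (\<pi> i) (f (\<phi> i))" for i
  let ?J = "orbit_ideal N k (f ` {..<\<phi> m})"
  have J: "ideal ?J (good_ring N k)" by (rule ideal_orbit_ideal[OF sub(2)])
  have "T i \<in> ?J" if i: "i < m" for i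
    unfolding T_def
  proof (rule good_ideal_mult[OF J])
    have "f (\<phi> i) \<in> f ` {..<\<phi> m}" using strict_monoD[OF \<phi>(1) i] by blast
    then show "inc_act (\<pi> i) (f (\<phi> i)) \<in> ?J" by (intro orbit_in_orbit_ideal[OF sub(2)] \<pi>C(1) i)
    show "Poly_Mapping.single (C i) (a i) \<in> carrier (good_ring N k)"
      using \<pi>C(2)[OF i] by (simp add: good_ring_def)
  qed
  then have sum_J: "sum T {..<m} \<in> ?J" by (intro good_ideal_sum[OF J]) simp
  define g where "g = f (\<phi> m) - sum T {..<m}"
  have "g \<notin> ?J"
  proof
    assume "g \<in> ?J"
    then have "g + sum T {..<m} \<in> ?J" using sum_J by (rule good_ideal_add[OF J])
    then show False using f_notin[of "\<phi> m"] by (simp add: g_def)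
  qed
  then obtain B where B: "leading g B" by (rule ex_leading[OF nonzero[OF _ sub(1)]])
  have "sum T {..<m} \<in> I" by (rule subsetD[OF orbit_ideal_subset[OF I stable sub(1)] sum_J])
  then have "g \<in> I" unfolding g_def by (rule good_ideal_diff[OF I f_I])
  with \<open>g \<notin> ?J\<close> have g: "g \<in> I - ?J" by simp
  have T_lookup: "Poly_Mapping.lookup (T i) (A (\<phi> m)) = a i * c i"
    and T_keys: "B' \<in> Poly_Mapping.keys (T i) \<Longrightarrow> B' = A (\<phi> m) \<or> B' \<lessdot> A (\<phi> m)" if "i < m" for i B'
    using leading_monomial_times_shift[OF \<pi>C(1)[OF that] A[of "\<phi> i"], where a = "a i" and C = "C i"]
    unfolding \<pi>C(3)[OF that, symmetric] T_def c_def by simp_all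
  have "Poly_Mapping.lookup g (A (\<phi> m)) = 0"
    using c_m T_lookup by (simp add: g_def lookup_minus lookup_sum c_def)
  then have "B \<noteq> A (\<phi> m)" using B by (auto simp: leading_def in_keys_iff)
  moreover have "B = A (\<phi> m) \<or> B \<lessdot> A (\<phi> m)"
  proof (cases "B \<in> Poly_Mapping.keys (f (\<phi> m))")
    case True
    then show ?thesis using A[of "\<phi> m"] by (simp add: leading_def)
  next
    case False
    with B have "(\<Sum>i<m. Poly_Mapping.lookup (T i) B) \<noteq> 0"
      by (auto simp: leading_def in_keys_iff g_def lookup_minus lookup_sum)
    then obtain i where "i \<in> {..<m}" "Poly_Mapping.lookup (T i) B \<noteq> 0"
      by (rule sum.not_neutral_contains_not_neutral)
    then show ?thesis using T_keys by (simp add: in_keys_iff)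
  qed
  ultimately have "B \<lessdot> A (\<phi> m)" by blast
  moreover have "\<not> B \<lessdot> A (\<phi> m)" using f[of "\<phi> m"] g A B unfolding least_def by metis
  ultimately show False by simp
qed

theorem proposition4p1:
  fixes N :: nat and k :: "nat \<Rightarrow> nat"
  assumes "noetherian_ring (coeff_ring :: 'a::{comm_ring, comm_monoid_mult} ring)"
    and "\<And>p. p < N \<Longrightarrow> k p \<ge> 1"
  shows "equivariantly_noetherian_ring Inc_monoid
           (good_ring N k :: (expo \<Rightarrow>\<^sub>0 'a) ring) inc_act"
proof (rule equivariantly_noetherian_ring.intro[OF ring_monoid_action_inc_act],
    rule equivariantly_noetherian_ring_axioms.intro)
  fix I :: "(expo \<Rightarrow>\<^sub>0 'a) set"
  assume I: "ideal I (good_ring N k)"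
    and stable: "\<And>\<pi> f. \<pi> \<in> carrier Inc_monoid \<Longrightarrow> f \<in> I \<Longrightarrow> inc_act \<pi> f \<in> I"
  interpret I: ideal I "good_ring N k" by (rule I)
  have k: "\<forall>p<N. 1 \<le> k p" by (intro allI impI assms(2))
  have shift_stable: "inc_act \<pi> f \<in> I" if "strict_mono \<pi>" "f \<in> I" for \<pi> f
    by (rule stable) (use that in \<open>simp_all add: Inc_monoid_def\<close>)
  have "\<exists>F \<subseteq> I. finite F \<and> I = orbit_ideal N k F"
    by (rule stable_ideal_finitely_orbit_generated[OF assms(1) k I]) (rule shift_stable)
  then obtain F where F: "F \<subseteq> I" "finite F" "I = orbit_ideal N k F" by (elim exE conjE)
  show "\<exists>F \<subseteq> carrier (good_ring N k). finite F \<and>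
      I = Idl\<^bsub>good_ring N k\<^esub> (\<Union>f\<in>F. (\<lambda>\<pi>. inc_act \<pi> f) ` carrier Inc_monoid)"
  proof (intro exI[of _ F] conjI)
    show "F \<subseteq> carrier (good_ring N k)" using F(1) I.a_subset by (rule order_trans)
  qed (rule F(2), rule F(3)[unfolded orbit_ideal_def])
qed

end
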